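(* Let $a<b$ be real numbers, let $k\ge1$ be an integer, and let $f:[a,b]\to\mathbb{R}$ be such that $f,f',\ldots,f^{(k-1)}$ are absolutely continuous on $[a,b]$ and $$V_k:=\|f^{(k)}\|_T=\int_0^\pi\left|f^{(k+1)}(\mathsf{G}(\cos\theta))\right|d\theta<\infty,$$ where $f^{(k+1)}$ is the distributional derivative of $f^{(k)}$. Then for any integers $n$ and $d$ with $n-1\ge k$ and $k\le d\le 2n-k-1$, $$\|f-\mathsf{C}_{d,n}[f]\|_1\le\mathbb{T}_{d,n},$$ where, for integers $s\ge 0$, $\alpha\in\{0,1\}$, $\beta\in\{-1,0,1,2\}$, $$\Pi_{\alpha,\beta}(\eta):=\frac{1}{\prod_{i=-s}^{s-\alpha}(\eta+2i+\beta)},$$ and $\mathbb{T}_{d,n}$ is defined as follows, with $s$ the integer such that $k=2s$ or $k=2s+1$: (1) if $d=n-l$ for some $l=1,2,\ldots,n-k$, then $$\mathbb{T}_{d,n}:=\begin{cases}\left(\dfrac{b-a}{2}\right)^{k+2}\dfrac{4V_k}{k\pi}\left(\Pi_{1,1}(n-l)+\Pi_{1,2}(n-l)\right), & \text{if } k=2s,\\[2ex] \left(\dfrac{b-a}{2}\right)^{k+2}\dfrac{4V_k}{k\pi}\left(\Pi_{0,0}(n-l)+\Pi_{0,1}(n-l)\right), & \text{if } k=2s+1;\end{cases}$$ (2) if $d=n+l$ for some $l=0,1,\ldots,n-k-1$, then $$\mathbb{T}_{d,n}:=\begin{cases}\left(\dfrac{b-a}{2}\right)^{k+2}\dfrac{6V_k}{k\pi}\left(\Pi_{1,0}(n-l)+\Pi_{1,1}(n-l)\right),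 & \text{if } k=2s,\\[2ex] \left(\dfrac{b-a}{2}\right)^{k+2}\dfrac{6V_k}{k\pi}\left(\Pi_{0,-1}(n-l)+\Pi_{0,0}(n-l)\right), & \text{if } k=2s+1.\end{cases}$$
   Context: The map $\mathsf{G}:[-1,1]\to[a,b]$ is the bijection $\mathsf{G}(t)=a+\frac{b-a}{2}(t+1)$, and $T_j(t)=\cos(j\cos^{-1}t)$ is the Chebyshev polynomial of the first kind of degree $j$. The norm is $\|g\|_1=\int_a^b|g(x)|\,dx$. For integers $n\ge1$ and $j\ge 0$, the approximated Chebyshev coefficients of $f:[a,b]\to\mathbb{R}$ with $n$ quadrature points are $$c_{j,n}=\frac{2}{n}\sum_{l=1}^{n}f(\mathsf{G}(t_l))T_j(t_l),\qquad t_l=\cos\left(\frac{(2l-1)\pi}{2n}\right),\quad l=1,\ldots,n.$$ The truncated Chebyshev series of $f$ with approximated coefficients is $$\mathsf{C}_{d,n}[f](x)=\frac{c_{0,n}}{2}+\sum_{j=1}^{d}c_{j,n}T_j(\mathsf{G}^{-1}(x)),\qquad x\in[a,b].$$ For a function $h$ on $[a,b]$, $\|h\|_T:=\int_0^\pi|h'(\mathsf{G}(\cos\theta))|\,d\theta$, where $h'$ is the weak (distributional) derivative. If $h$ is absolutely continuous, this is an ordinary Lebesgue integral. If the distributional derivative of $h$ on $(a,b)$ is only a signed Radon measure $Dh$ (for example, if $h$ has jumps), then, by the change of variables $x=\mathsf{G}(\cos\theta)$, the integral is understood as $\|h\|_T=\int_{(a,b)}\frac{d|Dh|(x)}{\sqrt{(x-a)(b-x)}}$,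 where $|Dh|$ is the total variation measure. The condition $\|h\|_T<\infty$ includes the requirement that the distributional derivative of $h$ is such a measure. *)

theory Defs
  imports "HOL-Analysis.Analysis"
begin

definition cheb_T :: "nat \<Rightarrow> real \<Rightarrow> real" where
  "cheb_T j t = cos (real j * arccos t)"

definition G_map :: "real \<Rightarrow> real \<Rightarrow> real \<Rightarrow> real" where
  "G_map a b t = a + (b - a) / 2 * (t + 1)"

definition G_inv :: "real \<Rightarrow> real \<Rightarrow> real \<Rightarrow> real" where
  "G_inv a b = inv_into {-1..1} (G_map a b)"

definition cheb_node :: "nat \<Rightarrow> nat \<Rightarrow> real" where
  "cheb_node n l = cos ((2 * real l - 1) * pi / (2 * real n))"

definition cheb_coeff :: "real \<Rightarrow> real \<Rightarrow> (real \<Rightarrow> real) \<Rightarrow> nat \<Rightarrow> nat \<Rightarrow> real" where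
  "cheb_coeff a b f j n =
     2 / real n * (\<Sum>l=1..n. f (G_map a b (cheb_node n l)) * cheb_T j (cheb_node n l))"

definition cheb_series :: "real \<Rightarrow> real \<Rightarrow> nat \<Rightarrow> nat \<Rightarrow> (real \<Rightarrow> real) \<Rightarrow> real \<Rightarrow> real" where
  "cheb_series a b d n f x =
     cheb_coeff a b f 0 n / 2 + (\<Sum>j=1..d. cheb_coeff a b f j n * cheb_T j (G_inv a b x))"

definition L1_norm :: "real \<Rightarrow> real \<Rightarrow> (real \<Rightarrow> real) \<Rightarrow> real" where
  "L1_norm a b g = (LINT x:{a..b}|lebesgue. \<bar>g x\<bar>)"

definition abs_cont_on :: "real \<Rightarrow> real \<Rightarrow> (real \<Rightarrow> real) \<Rightarrow> bool" where
  "abs_cont_on a b g \<longleftrightarrow>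
     (\<forall>\<epsilon>>0. \<exists>\<delta>>0. \<forall>(m::nat) u v.
        (\<forall>i<m. a \<le> u i \<and> u i < v i \<and> v i \<le> b) \<and>
        disjoint_family_on (\<lambda>i. {u i<..<v i}) {..<m} \<and>
        (\<Sum>i<m. v i - u i) < \<delta>
        \<longrightarrow> (\<Sum>i<m. \<bar>g (v i) - g (u i)\<bar>) < \<epsilon>)"

text \<open>
  \<open>D i\<close> is the \<open>i\<close>-th derivative of \<open>f\<close> on \<open>[a,b]\<close> (one-sided at the endpoints) for \<open>i < k\<close>,
  and all of these are absolutely continuous. The derivative of the absolutely continuous
  \<open>D (k - 1)\<close> exists only almost everywhere, and \<open>D k\<close> is any representative of it.
\<close>
definition abs_cont_derivs ::
    "real \<Rightarrow> real \<Rightarrow> nat \<Rightarrow> (real \<Rightarrow> real) \<Rightarrow> (nat \<Rightarrow> real \<Rightarrow> real) \<Rightarrow> bool" where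
  "abs_cont_derivs a b k f D \<longleftrightarrow>
     (\<forall>x\<in>{a..b}. D 0 x = f x) \<and>
     (\<forall>i. Suc i < k \<longrightarrow>
        (\<forall>x\<in>{a..b}. (D i has_real_derivative D (Suc i) x) (at x within {a..b}))) \<and>
     (\<forall>i<k. abs_cont_on a b (D i)) \<and>
     (AE x in lebesgue. x \<in> {a<..<b} \<longrightarrow>
        (D (k - 1) has_real_derivative D k x) (at x))"

text \<open>Test functions in \<open>C\<^sub>c\<^sup>\<infinity>(a,b)\<close>, extended by zero to the real line.\<close>
definition test_function :: "real \<Rightarrow> real \<Rightarrow> (real \<Rightarrow> real) \<Rightarrow> bool" where
  "test_function a b \<phi> \<longleftrightarrow>
     (\<forall>m x. (deriv ^^ m) \<phi> differentiable (at x)) \<and>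
     compact (closure {x. \<phi> x \<noteq> 0}) \<and> closure {x. \<phi> x \<noteq> 0} \<subseteq> {a<..<b}"

text \<open>On an interval, every Borel measure that is finite on compact sets is regular.\<close>
definition radon_measure_on :: "real \<Rightarrow> real \<Rightarrow> real measure \<Rightarrow> bool" where
  "radon_measure_on a b M \<longleftrightarrow>
     sets M = sets (restrict_space borel {a<..<b}) \<and>
     (\<forall>K. compact K \<and> K \<subseteq> {a<..<b} \<longrightarrow> emeasure M K < \<infinity>)"

definition mutually_singular :: "'a measure \<Rightarrow> 'a measure \<Rightarrow> bool" where
  "mutually_singular P N \<longleftrightarrow>
     (\<exists>A\<in>sets P. emeasure P A = 0 \<and> emeasure N (space P - A) = 0)"

text \<open>
  The distributional derivative of \<open>h\<close> on \<open>(a,b)\<close> is the signed Radon measure \<open>P - N\<close>, given by its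
  Jordan decomposition; its total variation measure is thus \<open>P + N\<close>.
\<close>
definition distr_deriv_measure ::
    "real \<Rightarrow> real \<Rightarrow> (real \<Rightarrow> real) \<Rightarrow> real measure \<Rightarrow> real measure \<Rightarrow> bool" where
  "distr_deriv_measure a b h P N \<longleftrightarrow>
     radon_measure_on a b P \<and> radon_measure_on a b N \<and> mutually_singular P N \<and>
     (\<forall>K. compact K \<and> K \<subseteq> {a<..<b} \<longrightarrow> set_integrable lebesgue K h) \<and>
     (\<forall>\<phi>. test_function a b \<phi> \<longrightarrow>
        (LINT x:{a<..<b}|lebesgue. h x * deriv \<phi> x) =
          - ((LINT x|P. \<phi> x) - (LINT x|N. \<phi> x)))"

text \<open>
  The integral of \<open>1 / sqrt ((x - a) * (b - x))\<close> against the total variation measure of the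
  distributional derivative of \<open>h\<close>. That derivative and its Jordan decomposition are unique, so the
  infimum ranges over at most one value; it is \<open>\<infinity>\<close> if the derivative is not a signed Radon measure.
\<close>
definition T_norm :: "real \<Rightarrow> real \<Rightarrow> (real \<Rightarrow> real) \<Rightarrow> ennreal" where
  "T_norm a b h =
     (INF (P, N)\<in>{(P, N). distr_deriv_measure a b h P N}.
        (\<integral>\<^sup>+x. ennreal (1 / sqrt ((x - a) * (b - x))) \<partial>P) +
        (\<integral>\<^sup>+x. ennreal (1 / sqrt ((x - a) * (b - x))) \<partial>N))"

definition Pi_ab :: "nat \<Rightarrow> int \<Rightarrow> int \<Rightarrow> real \<Rightarrow> real" where
  "Pi_ab s \<alpha> \<beta> \<eta> =
     1 / (\<Prod>i\<in>{- int s..int s - \<alpha>}. \<eta> + 2 * real_of_int i + real_of_int \<beta>)"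

definition T_bound :: "real \<Rightarrow> real \<Rightarrow> nat \<Rightarrow> real \<Rightarrow> nat \<Rightarrow> nat \<Rightarrow> real" where
  "T_bound a b k V d n =
     (let s = k div 2 in
      if d < n then
        let l = n - d; \<eta> = real n - real l in
        if even k then
          ((b - a) / 2) ^ (k + 2) * (4 * V / (real k * pi)) * (Pi_ab s 1 1 \<eta> + Pi_ab s 1 2 \<eta>)
        else
          ((b - a) / 2) ^ (k + 2) * (4 * V / (real k * pi)) * (Pi_ab s 0 0 \<eta> + Pi_ab s 0 1 \<eta>)
      else
        let l = d - n; \<eta> = real n - real l in
        if even k then
          ((b - a) / 2) ^ (k + 2) * (6 * V / (real k * pi)) * (Pi_ab s 1 0 \<eta> + Pi_ab s 1 1 \<eta>)
        else
          ((b - a) / 2) ^ (k + 2) * (6 * V / (real k * pi)) * (Pi_ab s 0 (- 1) \<eta> + Pi_ab s 0 0 \<eta>))"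

end

theory Submission
  imports Defs
begin

text \<open>
  Put \<open>x = G (cos \<theta>)\<close>, so that the Chebyshev expansion of \<open>f\<close> becomes the cosine series of
  \<open>F \<theta> = f (G (cos \<theta>))\<close>, with coefficients \<open>c\<^sub>j\<close>. Each integration by parts replaces \<open>c\<^sub>j\<close> by a
  difference of the neighbouring coefficients of the next derivative, divided by \<open>2 j\<close>; the resulting
  weights telescope to \<open>\<bar>c\<^sub>j\<bar> \<le> 2 r ^ (k + 1) V / (\<pi> \<Prod>\<^sub>i (j - k + 2 i))\<close> with \<open>r = (b - a) / 2\<close> and
  \<open>i\<close> from \<open>0\<close> to \<open>k\<close>. The last two steps use only that the second distributional derivative of the
  absolutely continuous function \<open>D (k - 1)\<close> is a measure, tested against smooth cutoffs of an explicit
  function. By discrete orthogonality, the error operator annihilates \<open>cos m\<theta>\<close> for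
  \<open>m < min (d + 1) (2 n - d)\<close>. It maps every other \<open>cos m\<theta>\<close> to a function bounded by \<open>2\<close> if \<open>d < n\<close>,
  when at most one frequency of \<open>C\<^bsub>d,n\<^esub>\<close> is aliased to \<open>m\<close>, and by \<open>3\<close> otherwise, when there may be two. The
  sum of the remaining \<open>\<bar>c\<^sub>j\<bar>\<close> telescopes, and the supremum bound times \<open>b - a\<close> is the claim.
\<close>

subsection \<open>Absolutely continuous functions\<close>

text \<open>The function \<open>D k\<close> is only some representative, so no Stieltjes integration
  by parts against it is available: its derivative enters solely through pairings with compactly
  supported smooth functions. The natural partner, \<open>psi m (arccos t)\<close>, behaves like a
  3/2-th power at the endpoints and is not a test function; this forces the cutoffs and a dominated
  limit. From the pairing only the supremum of the test function is kept: the weight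
  \<open>1 / sqrt ((x - a) * (b - x))\<close> is at least \<open>1 / r\<close>, so
  \<open>r * T_norm\<close> dominates the total variation, and the supremum
  \<open>1 / (m^2 - 1)\<close> of \<open>psi m\<close> is already the decay factor for
  \<open>k = 1\<close>. Classical integration by parts does the rest. The four cases of
  \<open>T_bound\<close> are one formula: each \<Pi> is \<open>decay (k - 1)\<close> at
  \<open>M - 1\<close> or \<open>M\<close>, where \<open>M = min (d + 1) (2 * n - d)\<close>. The
  constants are \<open>2 * r\<close> (length of the interval) times 2 or 3 (error operator) times
  \<open>2 / pi\<close> (normalization of the coefficients) times \<open>1 / (2 * k)\<close>
  (telescoping), which gives 4 or 6 over \<open>k * pi\<close>.\<close>

lemma abs_cont_on_finite:
  assumes "abs_cont_on a b g" "\<epsilon> > 0"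
  shows "\<exists>\<delta>>0. \<forall>(I :: 'i set) u v. finite I \<and> (\<forall>i\<in>I. a \<le> u i \<and> u i < v i \<and> v i \<le> b) \<and>
       disjoint_family_on (\<lambda>i. {u i<..<v i}) I \<and> (\<Sum>i\<in>I. v i - u i) < \<delta> \<longrightarrow>
       (\<Sum>i\<in>I. \<bar>g (v i) - g (u i)\<bar>) < \<epsilon>"
proof -
  obtain \<delta> where \<delta>: "\<delta> > 0"
    and *: "\<forall>(m::nat) u v. (\<forall>i<m. a \<le> u i \<and> u i < v i \<and> v i \<le> b) \<and>
        disjoint_family_on (\<lambda>i. {u i<..<v i}) {..<m} \<and> (\<Sum>i<m. v i - u i) < \<delta>
        \<longrightarrow> (\<Sum>i<m. \<bar>g (v i) - g (u i)\<bar>) < \<epsilon>"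
    using assms unfolding abs_cont_on_def by blast
  show ?thesis
  proof (intro exI[of _ \<delta>] conjI allI impI; (elim conjE)?)
    fix I :: "'i set" and u v
    assume I: "finite I" and uv: "\<forall>i\<in>I. a \<le> u i \<and> u i < v i \<and> v i \<le> b"
      and dis: "disjoint_family_on (\<lambda>i. {u i<..<v i}) I" and len: "(\<Sum>i\<in>I. v i - u i) < \<delta>"
    \<comment> \<open>The definition speaks of families indexed by an initial segment of the
      naturals; an enumeration of \<open>I\<close> admits index sets such as sets of tagged
      intervals.\<close>
    obtain e where e: "bij_betw e {..<card I} I"
      using ex_bij_betw_nat_finite[OF I] by (auto simp: atLeast0LessThan)
    have eI: "e i \<in> I" if "i < card I" for i
      using e that by (auto simp: bij_betw_def)
    have inj: "inj_on e {..<card I}" using e by (auto simp: bij_betw_def)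
    have "(\<Sum>i<card I. \<bar>g ((v \<circ> e) i) - g ((u \<circ> e) i)\<bar>) < \<epsilon>"
    proof (rule *[rule_format], intro conjI)
      show "\<forall>i<card I. a \<le> (u \<circ> e) i \<and> (u \<circ> e) i < (v \<circ> e) i \<and> (v \<circ> e) i \<le> b"
        using eI uv by auto
      show "disjoint_family_on (\<lambda>i. {(u \<circ> e) i<..<(v \<circ> e) i}) {..<card I}"
        unfolding disjoint_family_on_def
      proof (intro ballI impI)
        fix i j assume ij: "i \<in> {..<card I}" "j \<in> {..<card I}" "i \<noteq> j"
        then have "e i \<noteq> e j" using inj by (auto dest: inj_onD)
        then show "{(u \<circ> e) i<..<(v \<circ> e) i} \<inter> {(u \<circ> e) j<..<(v \<circ> e) j} = {}"
          using disjoint_family_onD[OF dis eI eI, of i j] ij by simp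
      qed
      have "(\<Sum>i<card I. (v \<circ> e) i - (u \<circ> e) i) = (\<Sum>i\<in>I. v i - u i)"
        unfolding comp_def using sum.reindex_bij_betw[OF e, of "\<lambda>i. v i - u i"] by simp
      then show "(\<Sum>i<card I. (v \<circ> e) i - (u \<circ> e) i) < \<delta>" using len by simp
    qed
    moreover have "(\<Sum>i<card I. \<bar>g ((v \<circ> e) i) - g ((u \<circ> e) i)\<bar>) = (\<Sum>i\<in>I. \<bar>g (v i) - g (u i)\<bar>)"
      unfolding comp_def using sum.reindex_bij_betw[OF e, of "\<lambda>i. \<bar>g (v i) - g (u i)\<bar>"] by simp
    ultimately show "(\<Sum>i\<in>I. \<bar>g (v i) - g (u i)\<bar>) < \<epsilon>" by simp
  qed (fact \<delta>)
qed

lemma abs_cont_on_imp_continuous_on: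
  assumes "abs_cont_on a b g"
  shows "continuous_on {a..b} g"
  unfolding continuous_on_iff
proof (intro ballI allI impI)
  fix x and e :: real assume x: "x \<in> {a..b}" and e: "e > 0"
  obtain \<delta> where \<delta>: "\<delta> > 0" and
    *: "\<forall>(I :: unit set) u v. finite I \<and> (\<forall>i\<in>I. a \<le> u i \<and> u i < v i \<and> v i \<le> b) \<and>
       disjoint_family_on (\<lambda>i. {u i<..<v i}) I \<and> (\<Sum>i\<in>I. v i - u i) < \<delta> \<longrightarrow>
       (\<Sum>i\<in>I. \<bar>g (v i) - g (u i)\<bar>) < e"
    using abs_cont_on_finite[OF assms e] by blast
  have **: "\<bar>g q - g p\<bar> < e" if "p \<in> {a..b}" "q \<in> {a..b}" "p < q" "q - p < \<delta>" for p q
    using *[rule_format, of "{()}" "\<lambda>_. p" "\<lambda>_. q"] that by (auto simp: disjoint_family_on_def)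
  show "\<exists>d>0. \<forall>x'\<in>{a..b}. dist x' x < d \<longrightarrow> dist (g x') (g x) < e"
  proof (intro exI conjI ballI impI)
    fix x' assume "x' \<in> {a..b}" "dist x' x < \<delta>"
    then show "dist (g x') (g x) < e"
      using **[of x x'] **[of x' x] x e by (cases x x' rule: linorder_cases) (auto simp: dist_real_def)
  qed (fact \<delta>)
qed

text \<open>A Henstock--Kurzweil argument: on the exceptional null set the gauge keeps the division inside an
  open set of small measure, where absolute continuity controls the increments of \<open>F\<close>.\<close>
theorem abs_cont_on_has_integral:
  assumes ab: "a \<le> b" and F: "abs_cont_on a b F" and E: "negligible E"
    and deriv: "\<And>x. x \<in> {a<..<b} - E \<Longrightarrow> (F has_real_derivative g x) (at x)"
  shows "(g has_integral F b - F a) {a..b}"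
proof (cases "a = b")
  case False
  with ab have ab: "a < b" by simp
  \<comment> \<open>No derivative is assumed at the endpoints, so they join the exceptional set.
    With \<open>g'\<close> zero there, an interval tagged in \<open>E'\<close> contributes only its
    increment of \<open>F\<close>.\<close>
  define E' where "E' = E \<union> {a, b}"
  define g' where "g' = (\<lambda>x. if x \<in> E' then 0 else g x)"
  have E': "negligible E'" using E by (simp add: E'_def)
  have "(g' has_integral F b - F a) {a..b}"
    unfolding has_integral_factor_content_real
  proof (intro allI impI)
    fix e :: real assume e: "e > 0"
    then have e2: "e * (b - a) / 2 > 0" using ab by simp
    obtain \<delta> where \<delta>: "\<delta> > 0" and
      AC: "\<forall>(I :: (real \<times> real set) set) u v. finite I \<and> (\<forall>i\<in>I. a \<le> u i \<and> u i < v i \<and> v i \<le> b) \<and>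
        disjoint_family_on (\<lambda>i. {u i<..<v i}) I \<and> (\<Sum>i\<in>I. v i - u i) < \<delta> \<longrightarrow>
        (\<Sum>i\<in>I. \<bar>F (v i) - F (u i)\<bar>) < e * (b - a) / 2"
      using abs_cont_on_finite[OF F e2] by blast
    have E'0: "E' \<in> null_sets lebesgue" using E' by (simp add: negligible_iff_null_sets)
    then have "E' \<in> sets lebesgue" by auto
    then obtain U where U: "open U" "E' \<subseteq> U" "emeasure lebesgue (U - E') < ennreal \<delta>"
      using sets_lebesgue_outer_open \<delta> by metis
    have "emeasure lebesgue U = emeasure lebesgue (U - E')"
      using emeasure_Diff_null_set[OF E'0, of U] U(1) by simp
    with U have U\<delta>: "emeasure lebesgue U < ennreal \<delta>" by simp
    have "\<exists>d>0. (x \<in> E' \<longrightarrow> ball x d \<subseteq> U) \<and>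
        (x \<in> {a..b} - E' \<longrightarrow> (\<forall>y. \<bar>y - x\<bar> < d \<longrightarrow> \<bar>F y - F x - g x * (y - x)\<bar> \<le> e / 2 * \<bar>y - x\<bar>))" for x
    proof (cases "x \<in> E'")
      case True
      then show ?thesis using U open_contains_ball by blast
    next
      case xE: False
      show ?thesis
      proof (cases "x \<in> {a..b}")
        case True
        with xE have "x \<in> {a<..<b} - E" by (auto simp: E'_def)
        from deriv[OF this] have "(F has_derivative (\<lambda>h. g x * h)) (at x)"
          by (simp add: has_field_derivative_def)
        then have "\<exists>d>0. \<forall>y. norm (y - x) < d \<longrightarrow> norm (F y - F x - g x * (y - x)) \<le> e / 2 * norm (y - x)"
          using e unfolding has_derivative_at_alt by (meson half_gt_zero)
        then show ?thesis using xE by auto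
      qed (use xE in \<open>auto intro: exI[of _ 1]\<close>)
    qed
    then obtain \<gamma> where \<gamma>: "\<And>x. \<gamma> x > 0" "\<And>x. x \<in> E' \<Longrightarrow> ball x (\<gamma> x) \<subseteq> U"
      "\<And>x y. x \<in> {a..b} - E' \<Longrightarrow> \<bar>y - x\<bar> < \<gamma> x \<Longrightarrow> \<bar>F y - F x - g x * (y - x)\<bar> \<le> e / 2 * \<bar>y - x\<bar>"
      by metis
    show "\<exists>d. gauge d \<and> (\<forall>p. p tagged_division_of {a..b} \<and> d fine p \<longrightarrow>
       norm ((\<Sum>(x, k)\<in>p. measure lborel k *\<^sub>R g' x) - (F b - F a)) \<le> e * measure lborel {a..b})"
    proof (intro exI[of _ "\<lambda>x. ball x (\<gamma> x)"] conjI allI impI; (elim conjE)?)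
      show "gauge (\<lambda>x. ball x (\<gamma> x))" using \<gamma>(1) by (auto simp: gauge_def)
      fix p assume p: "p tagged_division_of {a..b}" and fine: "(\<lambda>x. ball x (\<gamma> x)) fine p"
      note pD = tagged_division_ofD[OF p]
      have fin: "finite p" by (rule pD)
      have K: "\<exists>c d. K = {c..d} \<and> c \<le> x \<and> x \<le> d \<and> a \<le> c \<and> d \<le> b \<and> Inf K = c \<and> Sup K = d \<and> measure lborel K = d - c
           \<and> {c..d} \<subseteq> ball x (\<gamma> x) \<and> interior K = {c<..<d}"
        if xK: "(x, K) \<in> p" for x K
      proof -
        obtain c d where cd: "K = {c..d}" using pD(4)[OF xK] by (auto simp: box_real)
        have "x \<in> {c..d}" "{c..d} \<subseteq> {a..b}" using pD(2,3)[OF xK] cd by auto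
        moreover have "{c..d} \<subseteq> ball x (\<gamma> x)" using fineD[OF fine xK] cd by simp
        ultimately show ?thesis unfolding cd by (intro exI[of _ c] exI[of _ d]) auto
      qed
      define h where "h = (\<lambda>(x::real, K::real set). \<bar>measure lborel K * g' x - (F (Sup K) - F (Inf K))\<bar>)"
      let ?p1 = "{(x, K). (x, K) \<in> p \<and> x \<in> E'}" and ?p2 = "{(x, K). (x, K) \<in> p \<and> x \<notin> E'}"
      \<comment> \<open>Absolute continuity is stated for nondegenerate intervals. Degenerate
        members of the division have zero length and zero increment and are left out.\<close>
      let ?I = "{(x, K). (x, K) \<in> p \<and> x \<in> E' \<and> Inf K < Sup K}"
      have fin1: "finite ?p1" "finite ?p2" "finite ?I"
        by (auto intro: finite_subset[OF _ fin])
      have sumI: "(\<Sum>i\<in>?I. \<bar>F ((Sup \<circ> snd) i) - F ((Inf \<circ> snd) i)\<bar>) < e * (b - a) / 2"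
      proof (rule AC[rule_format], intro conjI)
        have "a \<le> Inf L \<and> Inf L < Sup L \<and> Sup L \<le> b" if "(x, L) \<in> p" "Inf L < Sup L" for x L
          using that K[of x L] by auto
        then show "\<forall>i\<in>?I. a \<le> (Inf \<circ> snd) i \<and> (Inf \<circ> snd) i < (Sup \<circ> snd) i \<and> (Sup \<circ> snd) i \<le> b"
          by auto
        show dis: "disjoint_family_on (\<lambda>i. {(Inf \<circ> snd) i<..<(Sup \<circ> snd) i}) ?I"
          unfolding disjoint_family_on_def
        proof (intro ballI impI)
          fix i j assume ij: "i \<in> ?I" "j \<in> ?I" "i \<noteq> j"
          obtain x K y L where xy: "i = (x, K)" "j = (y, L)" by (cases i, cases j)
          have "interior K \<inter> interior L = {}" using pD(5)[of x K y L] ij xy by auto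
          moreover have "interior K = {Inf K<..<Sup K}" "interior L = {Inf L<..<Sup L}"
            using K[of x K] K[of y L] ij xy by force+
          ultimately show "{(Inf \<circ> snd) i<..<(Sup \<circ> snd) i} \<inter> {(Inf \<circ> snd) j<..<(Sup \<circ> snd) j} = {}"
            using xy by simp
        qed
        have "ennreal (\<Sum>i\<in>?I. (Sup \<circ> snd) i - (Inf \<circ> snd) i) =
            (\<Sum>i\<in>?I. ennreal ((Sup \<circ> snd) i - (Inf \<circ> snd) i))"
          by (subst sum_ennreal) auto
        also have "\<dots> = (\<Sum>i\<in>?I. emeasure lebesgue {(Inf \<circ> snd) i<..<(Sup \<circ> snd) i})"
          by (intro sum.cong refl) (auto)
        also have "\<dots> = emeasure lebesgue (\<Union>i\<in>?I. {(Inf \<circ> snd) i<..<(Sup \<circ> snd) i})"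
          by (rule sum_emeasure[OF _ dis fin1(3)]) auto
        also have "\<dots> \<le> emeasure lebesgue U"
        proof (rule emeasure_mono)
          show "(\<Union>i\<in>?I. {(Inf \<circ> snd) i<..<(Sup \<circ> snd) i}) \<subseteq> U"
          proof (clarsimp)
            fix y x K assume "(x, K) \<in> p" "x \<in> E'" "Inf K < y" "y < Sup K"
            with K[of x K] \<gamma>(2)[of x] show "y \<in> U" by fastforce
          qed
        qed (use U in auto)
        also note U\<delta>
        finally show "(\<Sum>i\<in>?I. (Sup \<circ> snd) i - (Inf \<circ> snd) i) < \<delta>"
          by (subst (asm) ennreal_less_iff) (auto intro: sum_nonneg)
      qed (rule fin1)
      have "sum h ?p1 = (\<Sum>i\<in>?I. \<bar>F ((Sup \<circ> snd) i) - F ((Inf \<circ> snd) i)\<bar>)"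
      proof (rule sum.mono_neutral_cong_right[OF fin1(1)])
        have "h (x, L) = 0" if "(x, L) \<in> p" "x \<in> E'" "\<not> Inf L < Sup L" for x L
        proof -
          have "Inf L = Sup L" "measure lborel L = Sup L - Inf L" using that K[of x L] by auto
          then show ?thesis by (simp add: h_def)
        qed
        then show "\<forall>i\<in>?p1 - ?I. h i = 0" by auto
      qed (auto simp: h_def g'_def)
      with sumI have 1: "sum h ?p1 \<le> e * (b - a) / 2" by simp
      have "h i \<le> e / 2 * measure lborel (snd i)" if "i \<in> ?p2" for i
      proof -
        obtain x K where xK: "i = (x, K)" "(x, K) \<in> p" "x \<notin> E'" using \<open>i \<in> ?p2\<close> by auto
        from K[OF xK(2)] obtain c d where cd: "K = {c..d}" "c \<le> x" "x \<le> d" "a \<le> c" "d \<le> b"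
          "Inf K = c" "Sup K = d" "measure lborel K = d - c" "{c..d} \<subseteq> ball x (\<gamma> x)" by blast
        then have cdK: "c \<in> {c..d}" "d \<in> {c..d}" by auto
        have "c \<in> ball x (\<gamma> x)" "d \<in> ball x (\<gamma> x)" using cd(9) cdK by blast+
        then have cdx: "\<bar>c - x\<bar> < \<gamma> x" "\<bar>d - x\<bar> < \<gamma> x" by (auto simp: dist_real_def)
        have xab: "x \<in> {a..b} - E'" using cd xK by auto
        have incr: "\<bar>F c - F x - g x * (c - x)\<bar> \<le> e / 2 * \<bar>c - x\<bar>"
          "\<bar>F d - F x - g x * (d - x)\<bar> \<le> e / 2 * \<bar>d - x\<bar>"
          by (rule \<gamma>(3)[OF xab cdx(1)], rule \<gamma>(3)[OF xab cdx(2)])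
        have sgn: "\<bar>c - x\<bar> = x - c" "\<bar>d - x\<bar> = d - x" using cd by auto
        \<comment> \<open>Straddle estimate: since the tag lies between \<open>c\<close> and
          \<open>d\<close>, the two error terms add up to a multiple of \<open>d - c\<close>
          itself.\<close>
        have "(d - c) * g x - (F d - F c) =
            (F c - F x - g x * (c - x)) - (F d - F x - g x * (d - x))" by (simp add: algebra_simps)
        also have "\<bar>\<dots>\<bar> \<le> \<bar>F c - F x - g x * (c - x)\<bar> + \<bar>F d - F x - g x * (d - x)\<bar>"
          by (rule abs_triangle_ineq4)
        also have "\<dots> \<le> e / 2 * (x - c) + e / 2 * (d - x)"
          using incr unfolding sgn by (rule add_mono)
        also have "\<dots> = e / 2 * (d - c)" unfolding distrib_left[symmetric] by simp
        finally show ?thesis using xK cd by (simp add: h_def g'_def)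
      qed
      then have "sum h ?p2 \<le> (\<Sum>i\<in>?p2. e / 2 * measure lborel (snd i))" by (rule sum_mono)
      also have "\<dots> \<le> (\<Sum>i\<in>p. e / 2 * measure lborel (snd i))"
        by (rule sum_mono2[OF fin]) (use e in auto)
      also have "\<dots> = e / 2 * (\<Sum>(x, K)\<in>p. measure lborel K)" by (simp add: sum_distrib_left case_prod_unfold)
      also have "\<dots> = e * (b - a) / 2"
        using additive_content_tagged_division[of p a b] p ab by (simp add: box_real)
      finally have 2: "sum h ?p2 \<le> e * (b - a) / 2" .
      have "(\<Sum>(x, K)\<in>p. measure lborel K *\<^sub>R g' x) - (F b - F a) =
          (\<Sum>(x, K)\<in>p. measure lborel K * g' x - (F (Sup K) - F (Inf K)))"
        using additive_tagged_division_1[OF less_imp_le[OF ab] p, of F]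
        by (simp add: sum_subtractf case_prod_unfold)
      also have "norm \<dots> \<le> sum h p"
        unfolding h_def using norm_sum[of "\<lambda>(x, K). measure lborel K * g' x - (F (Sup K) - F (Inf K))" p]
        by (simp add: case_prod_unfold)
      also have "p = ?p1 \<union> ?p2" by auto
      then have "sum h p = sum h ?p1 + sum h ?p2"
        using sum.union_disjoint[OF fin1(1,2), of h] by force
      finally show "norm ((\<Sum>(x, K)\<in>p. measure lborel K *\<^sub>R g' x) - (F b - F a)) \<le> e * measure lborel {a..b}"
        using 1 2 ab by simp
    qed
  qed
  then show ?thesis
    by (rule has_integral_spike[OF E', rotated]) (auto simp: g'_def)
qed auto

text \<open>On a compact interval \<open>q\<close> is bounded and Lipschitz. This extends the
  fundamental theorem to products \<open>W * q\<close>, which is integration by parts for an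
  absolutely continuous \<open>W\<close>.\<close>

lemma abs_cont_on_mult_C1:
  assumes W: "abs_cont_on a b W" and q: "\<And>x. (q has_real_derivative q' x) (at x)"
    and q': "continuous_on UNIV q'"
  shows "abs_cont_on a b (\<lambda>x. W x * q x)"
proof -
  have "bounded (W ` {a..b})" "bounded (q ` {a..b})" "bounded (q' ` {a..b})"
    using abs_cont_on_imp_continuous_on[OF W] continuous_on_subset[OF q' subset_UNIV]
      continuous_at_imp_continuous_on[of "{a..b}" q] DERIV_isCont[OF q]
    by (auto intro!: compact_imp_bounded compact_continuous_image)
  then obtain A B C where A': "\<forall>x\<in>{a..b}. \<bar>W x\<bar> \<le> A" "A > 0"
    and B': "\<forall>x\<in>{a..b}. \<bar>q x\<bar> \<le> B" "B > 0"
    and C': "\<forall>x\<in>{a..b}. \<bar>q' x\<bar> \<le> C" "C > 0"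
    unfolding bounded_pos by (auto simp del: atLeastAtMost_iff)
  note A = A'[rule_format] and B = B'[rule_format] and C = C'[rule_format]
  have lip: "\<bar>q y - q x\<bar> \<le> C * (y - x)" if xy: "a \<le> x" "x < y" "y \<le> b" for x y
  proof -
    obtain z where "x < z" "z < y" "q y - q x = (y - x) * q' z"
      using MVT2[of x y q q'] xy q by auto
    with C(1)[of z] xy show ?thesis by (simp add: abs_mult mult.commute mult_right_mono)
  qed
  show ?thesis
    unfolding abs_cont_on_def
  proof (intro allI impI)
    fix \<epsilon> :: real assume \<epsilon>: "\<epsilon> > 0"
    have "\<epsilon> / (2 * B) > 0" using \<epsilon> B by simp
    then obtain \<delta> where \<delta>: "\<delta> > 0" and AC: "\<forall>(m::nat) u v.
        (\<forall>i<m. a \<le> u i \<and> u i < v i \<and> v i \<le> b) \<and>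
        disjoint_family_on (\<lambda>i. {u i<..<v i}) {..<m} \<and> (\<Sum>i<m. v i - u i) < \<delta>
        \<longrightarrow> (\<Sum>i<m. \<bar>W (v i) - W (u i)\<bar>) < \<epsilon> / (2 * B)"
      using W unfolding abs_cont_on_def by blast
    show "\<exists>\<delta>>0. \<forall>(m::nat) u v.
        (\<forall>i<m. a \<le> u i \<and> u i < v i \<and> v i \<le> b) \<and>
        disjoint_family_on (\<lambda>i. {u i<..<v i}) {..<m} \<and> (\<Sum>i<m. v i - u i) < \<delta>
        \<longrightarrow> (\<Sum>i<m. \<bar>W (v i) * q (v i) - W (u i) * q (u i)\<bar>) < \<epsilon>"
    \<comment> \<open>Half of \<epsilon> pays for the variation of \<open>W\<close> times the bound
      \<open>B\<close> of \<open>q\<close>, the other half for the bound \<open>A\<close> of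
      \<open>W\<close> times the Lipschitz constant \<open>C\<close>.\<close>
    proof (intro exI[of _ "min \<delta> (\<epsilon> / (2 * A * C))"] conjI allI impI; (elim conjE)?)
      show "0 < min \<delta> (\<epsilon> / (2 * A * C))" using \<delta> \<epsilon> A C by simp
      fix m :: nat and u v
      assume uv: "\<forall>i<m. a \<le> u i \<and> u i < v i \<and> v i \<le> b"
        and dis: "disjoint_family_on (\<lambda>i. {u i<..<v i}) {..<m}"
        and len: "(\<Sum>i<m. v i - u i) < min \<delta> (\<epsilon> / (2 * A * C))"
      have "\<bar>W (v i) * q (v i) - W (u i) * q (u i)\<bar> \<le> B * \<bar>W (v i) - W (u i)\<bar> + A * C * (v i - u i)" if "i < m" for i
      proof -
        have uvi: "a \<le> u i" "u i < v i" "v i \<le> b" using uv that by auto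
        have "W (v i) * q (v i) - W (u i) * q (u i) = q (v i) * (W (v i) - W (u i)) + W (u i) * (q (v i) - q (u i))"
          by (simp add: algebra_simps)
        also have "\<bar>\<dots>\<bar> \<le> \<bar>q (v i)\<bar> * \<bar>W (v i) - W (u i)\<bar> + \<bar>W (u i)\<bar> * \<bar>q (v i) - q (u i)\<bar>"
          by (intro order_trans[OF abs_triangle_ineq]) (simp add: abs_mult)
        also have "\<dots> \<le> B * \<bar>W (v i) - W (u i)\<bar> + A * (C * (v i - u i))"
          using A(1)[of "u i"] A(2) B(1)[of "v i"] B(2) lip[of "u i" "v i"] uvi
          by (intro add_mono mult_mono) auto
        finally show ?thesis by (simp add: mult.assoc)
      qed
      then have "(\<Sum>i<m. \<bar>W (v i) * q (v i) - W (u i) * q (u i)\<bar>) \<le>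
          (\<Sum>i<m. B * \<bar>W (v i) - W (u i)\<bar> + A * C * (v i - u i))" by (intro sum_mono) auto
      also have "\<dots> = B * (\<Sum>i<m. \<bar>W (v i) - W (u i)\<bar>) + A * C * (\<Sum>i<m. v i - u i)"
        by (simp add: sum.distrib sum_distrib_left)
      also have "\<dots> < B * (\<epsilon> / (2 * B)) + A * C * (\<epsilon> / (2 * A * C))"
      proof (rule add_strict_mono; rule mult_strict_left_mono)
        show "(\<Sum>i<m. \<bar>W (v i) - W (u i)\<bar>) < \<epsilon> / (2 * B)" using AC uv dis len by simp
      qed (use len A B C in auto)
      also have "\<dots> = \<epsilon>" using A B C by simp
      finally show "(\<Sum>i<m. \<bar>W (v i) * q (v i) - W (u i) * q (u i)\<bar>) < \<epsilon>" .
    qed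
  qed
qed

subsection \<open>Smooth functions and cutoffs\<close>

text \<open>The derivative is existentially quantified, so closure under products, inverses and
  composition is an induction that exhibits a derivative, without computing any iterated
  \<open>deriv\<close>.\<close>

primrec ndiff :: "nat \<Rightarrow> real set \<Rightarrow> (real \<Rightarrow> real) \<Rightarrow> bool" where
  "ndiff 0 S f \<longleftrightarrow> True"
| "ndiff (Suc m) S f \<longleftrightarrow> (\<exists>f'. (\<forall>x\<in>S. (f has_real_derivative f' x) (at x)) \<and> ndiff m S f')"

lemma ndiff_SucI:
  assumes "\<And>x. x \<in> S \<Longrightarrow> (f has_real_derivative f' x) (at x)" "ndiff m S f'"
  shows "ndiff (Suc m) S f"
  using assms by auto

lemma ndiff_SucD: "ndiff (Suc m) S f \<Longrightarrow> ndiff m S f"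
proof (induction m arbitrary: f)
  case (Suc m)
  then obtain f' where "\<forall>x\<in>S. (f has_real_derivative f' x) (at x)" "ndiff (Suc m) S f'" by auto
  with Suc.IH[of f'] show ?case by (auto intro!: ndiff_SucI)
qed simp

lemma ndiff_const: "ndiff m S (\<lambda>_. c)"
  by (induction m arbitrary: c) (auto intro!: ndiff_SucI[where f' = "\<lambda>_. 0"] simp del: ndiff.simps(2))

lemma ndiff_ident: "ndiff m S (\<lambda>x. x)"
  by (cases m) (auto intro!: ndiff_SucI ndiff_const derivative_eq_intros)

lemma ndiff_add: "ndiff m S f \<Longrightarrow> ndiff m S g \<Longrightarrow> ndiff m S (\<lambda>x. f x + g x)"
proof (induction m arbitrary: f g)
  case (Suc m)
  then obtain f' g' where "\<forall>x\<in>S. (f has_real_derivative f' x) (at x)" "ndiff m S f'"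
    "\<forall>x\<in>S. (g has_real_derivative g' x) (at x)" "ndiff m S g'" by auto
  with Suc.IH[of f' g'] show ?case by (auto intro!: ndiff_SucI derivative_intros simp del: ndiff.simps(2))
qed simp

lemma ndiff_mult: "ndiff m S f \<Longrightarrow> ndiff m S g \<Longrightarrow> ndiff m S (\<lambda>x. f x * g x)"
proof (induction m arbitrary: f g)
  case (Suc m)
  then obtain f' g' where *: "\<forall>x\<in>S. (f has_real_derivative f' x) (at x)" "ndiff m S f'"
    "\<forall>x\<in>S. (g has_real_derivative g' x) (at x)" "ndiff m S g'" by auto
  have "ndiff m S f" "ndiff m S g" using Suc.prems by (auto dest: ndiff_SucD simp del: ndiff.simps)
  then have "ndiff m S (\<lambda>x. f' x * g x + g' x * f x)"
    using * Suc.IH by (intro ndiff_add) auto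
  then show ?case using * by (auto intro!: ndiff_SucI DERIV_mult simp del: ndiff.simps(2))
qed simp

lemma ndiff_cmult: "ndiff m S f \<Longrightarrow> ndiff m S (\<lambda>x. c * f x)"
  by (intro ndiff_mult ndiff_const)

lemma ndiff_diff:
  assumes "ndiff m S f" "ndiff m S g"
  shows "ndiff m S (\<lambda>x. f x - g x)"
  using ndiff_add[OF assms(1) ndiff_cmult[OF assms(2), of "-1"]] by simp

lemma ndiff_inverse:
  "ndiff m S f \<Longrightarrow> (\<And>x. x \<in> S \<Longrightarrow> f x \<noteq> 0) \<Longrightarrow> ndiff m S (\<lambda>x. inverse (f x))"
proof (induction m arbitrary: f)
  case (Suc m)
  then obtain f' where *: "\<forall>x\<in>S. (f has_real_derivative f' x) (at x)" "ndiff m S f'" by auto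
  have "ndiff m S f" using Suc.prems(1) by (rule ndiff_SucD)
  then have "ndiff m S (\<lambda>x. inverse (f x))" using Suc by blast
  then have "ndiff m S (\<lambda>x. -1 * (inverse (f x) * f' x * inverse (f x)))"
    using * by (intro ndiff_mult ndiff_const)
  then show ?case
    using * Suc.prems(2) by (intro ndiff_SucI) (auto intro!: DERIV_inverse')
qed simp

lemma ndiff_compose:
  "ndiff m T f \<Longrightarrow> ndiff m S g \<Longrightarrow> g ` S \<subseteq> T \<Longrightarrow> ndiff m S (\<lambda>x. f (g x))"
proof (induction m arbitrary: f)
  case (Suc m)
  then obtain f' g' where *: "\<forall>x\<in>T. (f has_real_derivative f' x) (at x)" "ndiff m T f'"
    "\<forall>x\<in>S. (g has_real_derivative g' x) (at x)" "ndiff m S g'" by auto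
  have "ndiff m S (\<lambda>x. f' (g x))" using Suc.IH[OF *(2) ndiff_SucD] Suc.prems by blast
  then have "ndiff m S (\<lambda>x. f' (g x) * g' x)" using * by (intro ndiff_mult)
  then show ?case
    using * Suc.prems(3) by (intro ndiff_SucI) (auto intro!: DERIV_chain2[where f = f])
qed simp

lemma ndiff_cong:
  assumes "open S" "\<And>x. x \<in> S \<Longrightarrow> f x = g x" "ndiff m S f"
  shows "ndiff m S g"
proof (cases m)
  case (Suc n)
  with assms(3) obtain f' where f': "\<forall>x\<in>S. (f has_real_derivative f' x) (at x)" "ndiff n S f'" by auto
  have "(g has_real_derivative f' x) (at x)" if "x \<in> S" for x
    using has_field_derivative_transform_within_open[of f "f' x" x S g] f' that assms by auto
  with f' show ?thesis unfolding Suc by (auto intro!: ndiff_SucI)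
qed simp

lemma ndiff_Suc_deriv:
  assumes "open S"
  shows "ndiff (Suc m) S f \<longleftrightarrow> (\<forall>x\<in>S. f differentiable (at x)) \<and> ndiff m S (deriv f)"
proof
  assume "ndiff (Suc m) S f"
  then obtain f' where f': "\<forall>x\<in>S. (f has_real_derivative f' x) (at x)" "ndiff m S f'" by auto
  have "ndiff m S (deriv f)"
    by (rule ndiff_cong[OF assms _ f'(2)]) (use f' DERIV_imp_deriv in fastforce)
  with f' show "(\<forall>x\<in>S. f differentiable (at x)) \<and> ndiff m S (deriv f)"
    by (auto simp: real_differentiable_def)
qed (auto intro!: ndiff_SucI simp del: ndiff.simps(2) simp: DERIV_deriv_iff_real_differentiable)

text \<open>On open sets both witnesses may be taken to be \<open>deriv f\<close>, so they agree on
  the overlap. This glues the interior formula of the cutoff to the zero function.\<close>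

lemma ndiff_Un:
  assumes "open S" "open T"
  shows "ndiff m S f \<Longrightarrow> ndiff m T f \<Longrightarrow> ndiff m (S \<union> T) f"
proof (induction m arbitrary: f)
  case (Suc m)
  then show ?case
    using ndiff_Suc_deriv[OF assms(1)] ndiff_Suc_deriv[OF assms(2)] ndiff_Suc_deriv[OF open_Un[OF assms]]
    by (auto simp del: ndiff.simps)
qed simp

lemma ndiff_deriv_funpow: "ndiff (m + n) UNIV f \<Longrightarrow> ndiff n UNIV ((deriv ^^ m) f)"
proof (induction m arbitrary: n)
  case (Suc m)
  then have "ndiff (Suc n) UNIV ((deriv ^^ m) f)" by (metis add_Suc_shift)
  then show ?case by (simp add: ndiff_Suc_deriv del: ndiff.simps)
qed simp

lemma ndiff_imp_deriv_differentiable: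
  assumes "\<And>m. ndiff m UNIV f"
  shows "(deriv ^^ m) f differentiable (at x)"
  using ndiff_deriv_funpow[of m 1 f] assms[of "m + 1"] by (simp add: ndiff_Suc_deriv del: ndiff.simps)

text \<open>The classical function that is smooth but not analytic at 0. The powers of
  \<open>inverse x\<close> are carried along because differentiation stays within this
  family.\<close>

definition flat :: "nat \<Rightarrow> real \<Rightarrow> real" where
  "flat i x = (if x > 0 then inverse x ^ i * exp (- inverse x) else 0)"

lemma flat_tendsto_0: "(flat i \<longlongrightarrow> 0) (at_right 0)"
proof -
  have "((\<lambda>x. inverse x ^ i / exp (inverse x)) \<longlongrightarrow> 0) (at_right (0::real))"
    using filterlim_compose[OF tendsto_power_div_exp_0[of i] filterlim_inverse_at_top_right] by simp
  moreover have "\<forall>\<^sub>F x in at_right 0. inverse x ^ i / exp (inverse x) = flat i x"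
    unfolding eventually_at_filter by (simp add: flat_def exp_minus field_simps)
  ultimately show ?thesis by (rule Lim_transform_eventually)
qed

lemma DERIV_flat:
  "(flat i has_real_derivative flat (i + 2) x - real i * flat (i + 1) x) (at x)"
proof (cases x "0::real" rule: linorder_cases)
  case less
  have "(flat i has_real_derivative 0) (at x)"
    by (rule has_field_derivative_transform_within_open[of "\<lambda>_. 0" _ _ "{..<0}"])
      (use less in \<open>auto simp: flat_def\<close>)
  then show ?thesis using less by (simp add: flat_def)
next
  case equal
  have "((\<lambda>h. flat i h / h) \<longlongrightarrow> 0) (at 0)"
  proof (rule filterlim_split_at_real)
    show "((\<lambda>h. flat i h / h) \<longlongrightarrow> 0) (at_left 0)"
      by (rule Lim_transform_eventually[OF tendsto_const])
        (auto simp: eventually_at_filter flat_def)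
    \<comment> \<open>Dividing by \<open>h\<close> only raises the exponent, so the difference
      quotient at 0 is another member of the family and tends to 0.\<close>
    have "\<forall>\<^sub>F h in at_right 0. flat (Suc i) h = flat i h / h"
      unfolding eventually_at_filter by (simp add: flat_def field_simps)
    then show "((\<lambda>h. flat i h / h) \<longlongrightarrow> 0) (at_right 0)"
      by (rule Lim_transform_eventually[OF flat_tendsto_0])
  qed
  then show ?thesis using equal by (simp add: DERIV_def flat_def)
next
  case greater
  have "((\<lambda>x. inverse x ^ i * exp (- inverse x)) has_real_derivative
      flat (i + 2) x - real i * flat (i + 1) x) (at x)"
    using greater
    by (auto intro!: derivative_eq_intros simp: flat_def)
      (cases i; simp add: field_simps power2_eq_square)
  then show ?thesis
    by (rule has_field_derivative_transform_within_open[of _ _ _ "{0<..}"])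
      (use greater in \<open>auto simp: flat_def\<close>)
qed

lemma ndiff_flat: "ndiff m UNIV (flat i)"
proof (induction m arbitrary: i)
  case (Suc m)
  show ?case
    by (rule ndiff_SucI[OF DERIV_flat]) (intro ndiff_diff ndiff_cmult Suc)
qed simp

text \<open>The standard smooth transition from 0 to 1 across the unit interval; \<open>x\<close>
  and \<open>1 - x\<close> are never both nonpositive, so the denominator does not vanish.\<close>

definition step :: "real \<Rightarrow> real" where
  "step x = flat 0 x * inverse (flat 0 x + flat 0 (1 - x))"

lemma flat_nonneg: "flat i x \<ge> 0"
  by (simp add: flat_def)

lemma flat_pos: "x > 0 \<Longrightarrow> flat i x > 0"
  by (simp add: flat_def)

lemma step_denom_pos: "flat 0 x + flat 0 (1 - x) > 0"
  using flat_nonneg[of 0 x] flat_nonneg[of 0 "1 - x"] flat_pos[of x 0] flat_pos[of "1 - x" 0]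
  by (cases "x > 0") (auto intro: add_pos_nonneg add_nonneg_pos)

lemma step_le_0: "x \<le> 0 \<Longrightarrow> step x = 0"
  by (simp add: step_def flat_def)

lemma step_ge_1: "x \<ge> 1 \<Longrightarrow> step x = 1"
  using step_denom_pos[of x] by (simp add: step_def) (simp add: flat_def)

lemma step_bounds: "0 \<le> step x" "step x \<le> 1"
  using step_denom_pos[of x] flat_nonneg[of 0 x] flat_nonneg[of 0 "1 - x"]
  by (auto simp: step_def field_simps)

lemma ndiff_step: "ndiff m UNIV step"
proof -
  have "ndiff m UNIV (\<lambda>x. flat 0 (1 - x))"
    by (rule ndiff_compose[OF ndiff_flat]) (intro ndiff_diff ndiff_const ndiff_ident, simp)
  then have "ndiff m UNIV (\<lambda>x. flat 0 x * inverse (flat 0 x + flat 0 (1 - x)))"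
    using step_denom_pos
    by (intro ndiff_mult ndiff_inverse ndiff_add ndiff_flat) (auto simp: less_le)
  then show ?thesis by (simp add: step_def[abs_def])
qed

lemma step_derivatives:
  obtains s1 s2 B where "\<forall>x. (step has_real_derivative s1 x) (at x)"
    "\<forall>x. (s1 has_real_derivative s2 x) (at x)" "\<forall>x. \<bar>s1 x\<bar> \<le> B" "\<forall>x. \<bar>s2 x\<bar> \<le> B"
    "\<forall>x. x < 0 \<or> x > 1 \<longrightarrow> s1 x = 0 \<and> s2 x = 0" "B > 0"
proof -
  \<comment> \<open>The third derivative serves only to make \<open>s2\<close> continuous, hence
    bounded on the compact transition interval.\<close>
  from ndiff_step[of 3] obtain s1 s2 s3 where s:
    "\<forall>x. (step has_real_derivative s1 x) (at x)"
    "\<forall>x. (s1 has_real_derivative s2 x) (at x)"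
    "\<forall>x. (s2 has_real_derivative s3 x) (at x)"
    by (auto simp: numeral_3_eq_3)
  have s10: "s1 x = 0" if "x < 0 \<or> x > 1" for x
  proof -
    define U where "U = (if x < 0 then {..<0::real} else {1<..})"
    have "(step has_real_derivative 0) (at x)"
      by (rule has_field_derivative_transform_within_open[of "\<lambda>_. if x < 0 then 0 else 1" _ _ U])
        (use that in \<open>auto simp: U_def step_le_0 step_ge_1\<close>)
    with s(1) show ?thesis using DERIV_unique by blast
  qed
  have s20: "s2 x = 0" if "x < 0 \<or> x > 1" for x
  proof -
    define U where "U = (if x < 0 then {..<0::real} else {1<..})"
    have "(s1 has_real_derivative 0) (at x)"
      by (rule has_field_derivative_transform_within_open[of "\<lambda>_. 0" _ _ U])
        (use that s10 in \<open>auto simp: U_def split: if_splits\<close>)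
    with s(2) show ?thesis using DERIV_unique by blast
  qed
  have cont: "continuous_on {0..1} s1" "continuous_on {0..1} s2"
    using s by (auto intro!: continuous_at_imp_continuous_on DERIV_isCont)
  have "bounded (s1 ` {0..1})" "bounded (s2 ` {0..1})"
    by (auto intro!: compact_imp_bounded compact_continuous_image cont)
  then obtain B1 B2 where B: "B1 > 0" "\<forall>x\<in>{0..1}. \<bar>s1 x\<bar> \<le> B1" "B2 > 0" "\<forall>x\<in>{0..1}. \<bar>s2 x\<bar> \<le> B2"
    unfolding bounded_pos by (auto simp del: atLeastAtMost_iff)
  show ?thesis
  proof (rule that[of s1 s2 "max B1 B2"])
    show "\<forall>x. \<bar>s1 x\<bar> \<le> max B1 B2"
    proof
      fix x show "\<bar>s1 x\<bar> \<le> max B1 B2"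
        using B s10[of x] by (cases "x \<in> {0..1}") (auto simp: le_max_iff_disj not_le)
    qed
    show "\<forall>x. \<bar>s2 x\<bar> \<le> max B1 B2"
    proof
      fix x show "\<bar>s2 x\<bar> \<le> max B1 B2"
        using B s20[of x] by (cases "x \<in> {0..1}") (auto simp: le_max_iff_disj not_le)
    qed
  qed (use s B s10 s20 in auto)
qed

text \<open>The three functions need a joint induction: the first two have each other and the
  inverse root in their derivatives, and the inverse root reproduces its own powers.\<close>

lemma ndiff_trig_arccos:
  "ndiff m {-1<..<1} (\<lambda>t. sin (c * arccos t)) \<and> ndiff m {-1<..<1} (\<lambda>t. cos (c * arccos t)) \<and>
   ndiff m {-1<..<1} (\<lambda>t. inverse (sqrt (1 - t\<^sup>2)))"
proof (induction m)
  case (Suc m)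
  let ?S = "\<lambda>t. sin (c * arccos t)" and ?C = "\<lambda>t. cos (c * arccos t)"
    and ?v = "\<lambda>t::real. inverse (sqrt (1 - t\<^sup>2))"
  have sq: "1 - t\<^sup>2 > 0" if "t \<in> {-1<..<1}" for t :: real
    using that by (simp add: abs_square_less_1 abs_less_iff)
  have nd: "ndiff m {-1<..<1} (\<lambda>t. - c * (?C t * ?v t))" "ndiff m {-1<..<1} (\<lambda>t. c * (?S t * ?v t))"
    "ndiff m {-1<..<1} (\<lambda>t. t * (?v t * (?v t * ?v t)))"
    using Suc by (intro ndiff_mult ndiff_const ndiff_ident; simp)+
  have "(?S has_real_derivative - c * (?C t * ?v t)) (at t)"
     "(?C has_real_derivative c * (?S t * ?v t)) (at t)"
     "(?v has_real_derivative t * (?v t * (?v t * ?v t))) (at t)" if t: "t \<in> {-1<..<1}" for t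
  proof -
    show "(?S has_real_derivative - c * (?C t * ?v t)) (at t)"
      "(?C has_real_derivative c * (?S t * ?v t)) (at t)"
      using t by (auto intro!: derivative_eq_intros simp: inverse_minus_eq)
    show "(?v has_real_derivative t * (?v t * (?v t * ?v t))) (at t)"
      using sq[OF t] by (auto intro!: derivative_eq_intros simp: field_simps)
  qed
  then show ?case using nd by (intro conjI ndiff_SucI) assumption+
qed simp

subsection \<open>Cosine integrals\<close>

lemma abs_sin_mult_le: "\<bar>sin (real m * x)\<bar> \<le> real m * \<bar>sin x\<bar>"
proof (induction m)
  case (Suc m)
  have "sin (real (Suc m) * x) = sin (real m * x) * cos x + cos (real m * x) * sin x"
    by (simp add: distrib_right sin_add add.commute)
  also have "\<bar>\<dots>\<bar> \<le> \<bar>sin (real m * x)\<bar> * \<bar>cos x\<bar> + \<bar>cos (real m * x)\<bar> * \<bar>sin x\<bar>"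
    by (intro order_trans[OF abs_triangle_ineq]) (simp add: abs_mult)
  also have "\<dots> \<le> \<bar>sin (real m * x)\<bar> * 1 + 1 * \<bar>sin x\<bar>"
    by (intro add_mono mult_left_mono mult_right_mono) auto
  finally show ?case using Suc by (simp add: distrib_right)
qed simp

text \<open>A crude form of Jordan's inequality: up to \<open>pi / 3\<close> the slope of sine is at
  least 1/2, beyond it sine is at least \<open>sqrt 3 / 2\<close> while \<open>x\<close> is below
  2.\<close>

lemma le_4_sin:
  assumes "0 \<le> x" "x \<le> pi / 2"
  shows "x \<le> 4 * sin x"
proof (cases "x \<le> pi / 3")
  case True
  show ?thesis
  proof (cases "x = 0")
    case False
    then obtain z where z: "0 < z" "z < x" "sin x - sin 0 = (x - 0) * cos z"
      using MVT2[of 0 x sin cos] assms by auto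
    have "cos z \<ge> 1 / 2"
      using cos_monotone_0_pi_le[of z "pi / 3"] z True pi_gt_zero by (simp add: cos_60)
    then have "x * (1 / 2) \<le> x * cos z" using assms by (intro mult_left_mono) auto
    then have "x \<le> 2 * sin x" using z by simp
    moreover have "sin x \<ge> 0" using assms pi_gt_zero by (intro sin_ge_zero) auto
    ultimately show ?thesis by linarith
  qed simp
next
  case False
  have "sin (pi / 3) \<le> sin x" using False assms by (intro sin_monotone_2pi_le) auto
  then have "sqrt 3 / 2 \<le> sin x" by (simp add: sin_60)
  moreover have "sqrt 3 \<ge> 1" by simp
  ultimately show ?thesis using assms pi_less_4 by linarith
qed

text \<open>The primitive of \<open>sin x * sin (m * x) / m\<close> that vanishes at both 0 and
  \<open>pi\<close>; \<open>m \<ge> 2\<close> keeps the first denominator nonzero. Since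
  \<open>d/dt = - (1 / sin x) d/dx\<close> for \<open>t = cos x\<close>, two differentiations in
  \<open>t\<close> leave \<open>cos (m * x) / sin x\<close>.\<close>

definition psi :: "nat \<Rightarrow> real \<Rightarrow> real" where
  "psi m x = (sin ((real m - 1) * x) / (real m - 1) - sin ((real m + 1) * x) / (real m + 1)) / (2 * real m)"

lemma DERIV_psi:
  assumes "m \<ge> 2"
  shows "(psi m has_real_derivative sin x * sin (real m * x) / real m) (at x)"
proof -
  have "(psi m has_real_derivative (cos ((real m - 1) * x) - cos ((real m + 1) * x)) / (2 * real m)) (at x)"
  proof -
    have aux: "((\<lambda>x. sin (c * x) / c) has_real_derivative cos (c * x)) (at x)" if "c \<noteq> 0" for c
      using that by (auto intro!: derivative_eq_intros)
    show ?thesis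
      unfolding psi_def[abs_def] using assms by (intro DERIV_cdivide DERIV_diff aux) auto
  qed
  moreover have "cos ((real m - 1) * x) - cos ((real m + 1) * x) = 2 * (sin x * sin (real m * x))"
    by (simp add: distrib_right left_diff_distrib cos_add cos_diff)
  ultimately show ?thesis by simp
qed

text \<open>Both sines are bounded by 1. The resulting value is
  \<open>decay (Suc 0) (real m)\<close>, from which the recursion over the derivatives
  starts.\<close>

lemma abs_psi_le:
  assumes "m \<ge> 2"
  shows "\<bar>psi m x\<bar> \<le> 1 / ((real m)\<^sup>2 - 1)"
proof -
  have m: "real m - 1 > 0" "real m + 1 > 0" "real m > 0" using assms by auto
  have "\<bar>psi m x\<bar> \<le> (\<bar>sin ((real m - 1) * x) / (real m - 1)\<bar> + \<bar>sin ((real m + 1) * x) / (real m + 1)\<bar>) / (2 * real m)"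
    unfolding psi_def abs_divide[of _ "2 * real m"] using m
    by (simp add: divide_right_mono abs_triangle_ineq4 del: abs_divide)
  also have "\<dots> \<le> (1 / (real m - 1) + 1 / (real m + 1)) / (2 * real m)"
    using m by (intro divide_right_mono add_mono) (auto simp: divide_right_mono)
  also have "\<dots> = 1 / ((real m)\<^sup>2 - 1)"
  proof -
    have "1 / (real m - 1) + 1 / (real m + 1) = 2 * real m / ((real m - 1) * (real m + 1))"
      using m by (simp add: field_simps)
    also have "(real m - 1) * (real m + 1) = (real m)\<^sup>2 - 1" by (simp add: algebra_simps power2_eq_square)
    finally show ?thesis using m by simp
  qed
  finally show ?thesis .
qed

text \<open>The derivative of \<open>psi m\<close> is at most \<open>sin^2\<close>, uniformly in
  \<open>m\<close>. As \<open>psi m\<close> vanishes at both ends, the mean value theorem from the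
  nearer end adds a factor comparable to the sine.\<close>

lemma abs_psi_le_sin_cubed:
  assumes m: "m \<ge> 2" and x: "0 < x" "x < pi"
  shows "\<bar>psi m x\<bar> \<le> 4 * sin x ^ 3"
proof -
  define \<psi>' where "\<psi>' = (\<lambda>x. sin x * sin (real m * x) / real m)"
  have d: "\<bar>\<psi>' z\<bar> \<le> (sin z)\<^sup>2" for z
  proof -
    have "\<bar>sin z\<bar> * \<bar>sin (real m * z)\<bar> \<le> \<bar>sin z\<bar> * (real m * \<bar>sin z\<bar>)"
      by (intro mult_left_mono abs_sin_mult_le) auto
    also have "\<dots> = real m * (sin z)\<^sup>2" by (simp add: power2_eq_square)
    finally show ?thesis using m by (simp add: \<psi>'_def abs_mult field_simps)
  qed
  have s0: "sin x > 0" using x by (rule sin_gt_zero)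
  show ?thesis
  proof (cases "x \<le> pi / 2")
    case True
    obtain z where z: "0 < z" "z < x" "psi m x - psi m 0 = (x - 0) * \<psi>' z"
      using MVT2[of 0 x "psi m" \<psi>'] DERIV_psi[OF m] x by (auto simp: \<psi>'_def)
    have "0 \<le> sin z" "sin z \<le> sin x"
      using z True x by (auto intro!: sin_ge_zero sin_monotone_2pi_le)
    then have "\<bar>\<psi>' z\<bar> \<le> (sin x)\<^sup>2" using order_trans[OF d power_mono] by blast
    then have "\<bar>psi m x\<bar> \<le> x * (sin x)\<^sup>2"
      using z x by (simp add: abs_mult psi_def mult_left_mono)
    also have "\<dots> \<le> 4 * sin x * (sin x)\<^sup>2" using le_4_sin[of x] x True by (intro mult_right_mono) auto
    finally show ?thesis by (simp add: power2_eq_square power3_eq_cube mult_ac)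
  next
    case False
    obtain z where z: "x < z" "z < pi" "psi m pi - psi m x = (pi - x) * \<psi>' z"
      using MVT2[of x pi "psi m" \<psi>'] DERIV_psi[OF m] x by (auto simp: \<psi>'_def)
    have "sin ((real m - 1) * pi) = 0" "sin ((real m + 1) * pi) = 0"
      using m sin_npi[of "m - 1"] sin_npi[of "m + 1"] by (simp_all add: of_nat_diff add.commute)
    then have "psi m pi = 0" by (simp add: psi_def)
    have "sin (pi - z) \<le> sin (pi - x)"
      using z False x by (intro sin_monotone_2pi_le) auto
    then have "0 \<le> sin z" "sin z \<le> sin x" using z x by (auto intro!: sin_ge_zero)
    then have "\<bar>\<psi>' z\<bar> \<le> (sin x)\<^sup>2" using order_trans[OF d power_mono] by blast
    moreover have "\<bar>psi m x\<bar> = (pi - x) * \<bar>\<psi>' z\<bar>"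
      using z x \<open>psi m pi = 0\<close> by (metis abs_minus_cancel abs_mult abs_of_pos diff_0 diff_gt_0_iff_gt)
    ultimately have "\<bar>psi m x\<bar> \<le> (pi - x) * (sin x)\<^sup>2"
      using x by (simp add: mult_left_mono)
    also have "\<dots> \<le> 4 * sin (pi - x) * (sin x)\<^sup>2"
      using le_4_sin[of "pi - x"] x False by (intro mult_right_mono) auto
    finally show ?thesis by (simp add: power2_eq_square power3_eq_cube mult_ac)
  qed
qed

text \<open>For \<open>t = cos x\<close> the argument of \<open>step\<close> is
  \<open>(N + 1) * sin^2 x - 1\<close>: the cutoff is 0 where \<open>sin^2 x\<close> is below
  \<open>1 / (N + 1)\<close> and equals \<open>psi m\<close> where it exceeds
  \<open>2 / (N + 1)\<close>.\<close>

definition cutoff :: "nat \<Rightarrow> nat \<Rightarrow> real \<Rightarrow> real" where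
  "cutoff m N t = step ((real N + 1) * (1 - t\<^sup>2) - 1) * psi m (arccos t)"

lemma cutoff_eq_0:
  assumes "1 - t\<^sup>2 < 1 / (real N + 1)"
  shows "cutoff m N t = 0"
proof -
  have "(real N + 1) * (1 - t\<^sup>2) \<le> 1" using assms by (simp add: field_simps)
  then show ?thesis by (simp add: cutoff_def step_le_0)
qed

lemma ndiff_cutoff:
  assumes "m \<ge> 2"
  shows "ndiff k UNIV (cutoff m N)"
proof -
  \<comment> \<open>These overlapping open sets cover the line: \<open>arccos\<close> is smooth on
    \<open>?S\<close>, and on \<open>?T\<close> the cutoff is identically 0, whatever
    \<open>arccos\<close> returns beyond -1 and 1.\<close>
  let ?S = "{-1<..<1::real}" and ?T = "{t::real. 1 - t\<^sup>2 < 1 / (real N + 1)}"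
  have T: "open ?T" by (intro open_Collect_less continuous_intros)
  have "ndiff k ?S (\<lambda>t. step ((real N + 1) * (1 - t * t) - 1))"
    by (rule ndiff_compose[OF ndiff_step]) (auto intro!: ndiff_diff ndiff_mult ndiff_const ndiff_ident)
  moreover have "ndiff k ?S (\<lambda>t. psi m (arccos t))"
    unfolding psi_def divide_inverse using ndiff_trig_arccos
    by (intro ndiff_mult ndiff_diff ndiff_const) auto
  ultimately have "ndiff k ?S (cutoff m N)"
    unfolding cutoff_def[abs_def] power2_eq_square by (rule ndiff_mult)
  moreover have "ndiff k ?T (cutoff m N)"
    by (rule ndiff_cong[OF T _ ndiff_const[of _ _ 0]]) (simp add: cutoff_eq_0)
  ultimately have "ndiff k (?S \<union> ?T) (cutoff m N)" using T by (intro ndiff_Un) auto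
  moreover have "?S \<union> ?T = UNIV"
  proof (intro equalityI subsetI UnCI)
    fix t :: real assume "t \<notin> ?T"
    then have "1 / (real N + 1) \<le> 1 - t\<^sup>2" by simp
    moreover have "0 < 1 / (real N + 1)" by simp
    ultimately have "0 < 1 - t\<^sup>2" by (rule less_le_trans[rotated])
    then have "t\<^sup>2 < 1" by simp
    then show "t \<in> ?S" by (auto simp: abs_square_less_1 abs_less_iff)
  qed simp
  ultimately show ?thesis by simp
qed

text \<open>The factor \<open>sin x\<close> is the Jacobian of \<open>t = cos x\<close> and cancels
  the singularity of the main term \<open>step u * cos (m * x)\<close>. Every other term carries a
  derivative of \<open>step\<close> and so lives in the transition zone only.\<close>

lemma deriv2_cutoff:
  fixes m N :: nat
  assumes m: "m \<ge> 2" and x: "0 < x" "x < pi"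
    and s1: "\<forall>x. (step has_real_derivative s1 x) (at x)" and s2: "\<forall>x. (s1 has_real_derivative s2 x) (at x)"
  defines "c \<equiv> real N + 1" and "u \<equiv> (real N + 1) * (sin x)\<^sup>2 - 1"
  shows "deriv (deriv (cutoff m N)) (cos x) * sin x =
    (s2 u * (4 * c\<^sup>2 * (cos x)\<^sup>2) - 2 * c * s1 u) * psi m x * sin x
    + 4 * c * cos x * s1 u * sin (real m * x) / real m * sin x + step u * cos (real m * x)"
proof -
  let ?u = "\<lambda>t::real. (real N + 1) * (1 - t\<^sup>2) - 1"
  let ?v = "\<lambda>t::real. inverse (sqrt (1 - t\<^sup>2))"
  have sq: "1 - t\<^sup>2 > 0" if "t \<in> {-1<..<1}" for t :: real
    using that by (simp add: abs_square_less_1 abs_less_iff)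
  define \<phi>1 where "\<phi>1 = (\<lambda>t. s1 (?u t) * (- 2 * c * t) * psi m (arccos t) - step (?u t) * (sin (real m * arccos t) / real m))"
  have psi: "((\<lambda>t. psi m (arccos t)) has_real_derivative - sin (real m * arccos t) / real m) (at t)"
    if t: "t \<in> {-1<..<1}" for t
  proof -
    have "((\<lambda>t. psi m (arccos t)) has_real_derivative
       (sin (arccos t) * sin (real m * arccos t) / real m) * inverse (- sqrt (1 - t\<^sup>2))) (at t)"
      by (rule DERIV_chain2[OF DERIV_psi[OF m] DERIV_arccos]) (use t in auto)
    moreover have "sin (arccos t) = sqrt (1 - t\<^sup>2)" using t by (intro sin_arccos) auto
    ultimately show ?thesis using sq[OF t] by (simp add: field_simps inverse_minus_eq)
  qed
  have du: "(?u has_real_derivative - 2 * c * t) (at t)" for t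
    by (auto intro!: derivative_eq_intros simp: c_def algebra_simps)
  have S: "((\<lambda>t. sin (real m * arccos t) / real m) has_real_derivative - cos (real m * arccos t) * ?v t) (at t)"
    if t: "t \<in> {-1<..<1}" for t
    using t m by (auto intro!: derivative_eq_intros simp: inverse_minus_eq)
  have 1: "(cutoff m N has_real_derivative \<phi>1 t) (at t)" if t: "t \<in> {-1<..<1}" for t
    unfolding cutoff_def[abs_def] \<phi>1_def
    using DERIV_mult[OF DERIV_chain2[OF s1[rule_format] du] psi[OF t]]
    by (rule DERIV_cong) (simp add: algebra_simps)
  have 2: "(\<phi>1 has_real_derivative
      (s2 (?u t) * (- 2 * c * t) * (- 2 * c * t) + s1 (?u t) * (- 2 * c)) * psi m (arccos t)
      + s1 (?u t) * (- 2 * c * t) * (- sin (real m * arccos t) / real m)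
      - (s1 (?u t) * (- 2 * c * t) * (sin (real m * arccos t) / real m)
      + step (?u t) * (- cos (real m * arccos t) * ?v t))) (at t)" if t: "t \<in> {-1<..<1}" for t
  proof -
    have lin: "((\<lambda>t. - 2 * c * t) has_real_derivative - 2 * c) (at t)"
      by (auto intro!: derivative_eq_intros)
    note D1 = DERIV_mult[OF DERIV_mult[OF DERIV_chain2[OF s2[rule_format] du] lin] psi[OF t]]
    note D2 = DERIV_mult[OF DERIV_chain2[OF s1[rule_format] du] S[OF t]]
    show ?thesis unfolding \<phi>1_def
      using DERIV_diff[OF D1 D2] by (rule DERIV_cong) (simp add: algebra_simps)
  qed
  have t: "cos x \<in> {-1<..<1}" and s: "sin x > 0"
    using x cos_monotone_0_pi[of 0 x] cos_monotone_0_pi[of x pi] sin_gt_zero[of x] by auto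
  have d1: "deriv (cutoff m N) t = \<phi>1 t" if "t \<in> {-1<..<1}" for t
    using 1[OF that] by (rule DERIV_imp_deriv)
  have "deriv (deriv (cutoff m N)) (cos x) = deriv \<phi>1 (cos x)"
    by (rule deriv_cong_ev) (use t d1 in \<open>auto simp: eventually_nhds intro!: exI[of _ "{-1<..<1}"]\<close>)
  also have "\<dots> = (s2 (?u (cos x)) * (- 2 * c * cos x) * (- 2 * c * cos x) + s1 (?u (cos x)) * (- 2 * c)) * psi m (arccos (cos x))
      + s1 (?u (cos x)) * (- 2 * c * cos x) * (- sin (real m * arccos (cos x)) / real m)
      - (s1 (?u (cos x)) * (- 2 * c * cos x) * (sin (real m * arccos (cos x)) / real m)
      + step (?u (cos x)) * (- cos (real m * arccos (cos x)) * ?v (cos x)))"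
    by (rule DERIV_imp_deriv[OF 2[OF t]])
  also have "1 - (cos x)\<^sup>2 = (sin x)\<^sup>2" by (simp add: sin_squared_eq)
  also have "(real N + 1) * (sin x)\<^sup>2 - 1 = u" by (simp add: u_def)
  finally have "deriv (deriv (cutoff m N)) (cos x) =
    (s2 u * (4 * c\<^sup>2 * (cos x)\<^sup>2) - 2 * c * s1 u) * psi m x
    + 4 * c * cos x * s1 u * sin (real m * x) / real m + step u * cos (real m * x) * inverse (sin x)"
    using x s by (simp add: arccos_cos algebra_simps power2_eq_square)
  then show ?thesis using s by (simp add: distrib_right)
qed

lemma continuous_on_deriv2:
  assumes "\<And>m. ndiff m UNIV f"
  shows "continuous_on S (deriv (deriv f))"
  using ndiff_imp_deriv_differentiable[OF assms, where m = 2]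
  by (auto simp: numeral_2_eq_2 intro!: continuous_at_imp_continuous_on differentiable_imp_continuous_within)

lemma integral_cos_substitution:
  assumes "continuous_on {-1..1} (f :: real \<Rightarrow> real)"
  shows "((\<lambda>x. f (cos x) * sin x) has_integral integral {-1..1} f) {0..pi}"
proof -
  have "((\<lambda>x. - sin x *\<^sub>R f (cos x)) has_integral (integral {cos 0..cos pi} f - integral {cos pi..cos 0} f)) {0..pi}"
    by (rule has_integral_substitution_general[of "{}" _ _ _ "-1" 1])
      (use assms in \<open>auto intro!: continuous_intros derivative_eq_intros\<close>)
  then have "((\<lambda>x. - (- sin x *\<^sub>R f (cos x))) has_integral - (0 - integral {-1..1} f)) {0..pi}"
    by (intro has_integral_neg) simp
  then show ?thesis by (simp add: mult.commute)
qed

text \<open>The pairing of the hypothesis is applied to smooth cutoffs of \<open>psi m (arccos t)\<close>, whose second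
  derivative in \<open>t\<close> is \<open>cos (m * arccos t) / sqrt (1 - t\<^sup>2)\<close>. In the variable \<open>x = arccos t\<close> the
  integrands stay bounded, since \<open>psi m\<close> is of order \<open>sin x ^ 3\<close> where the cutoff varies.\<close>
lemma cosine_integral_bound:
  fixes w :: "real \<Rightarrow> real"
  assumes w: "continuous_on {-1..1} w"
    and H: "\<And>\<phi> B \<delta>. (\<And>m. ndiff m UNIV \<phi>) \<Longrightarrow> \<delta> > 0 \<Longrightarrow> (\<And>t. 1 - t\<^sup>2 < \<delta> \<Longrightarrow> \<phi> t = 0) \<Longrightarrow>
        B > 0 \<Longrightarrow> (\<And>t. \<bar>\<phi> t\<bar> \<le> B) \<Longrightarrow> \<bar>integral {-1..1} (\<lambda>t. w t * deriv (deriv \<phi>) t)\<bar> \<le> K * B"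
    and m: "m \<ge> 2"
  shows "\<bar>integral {0..pi} (\<lambda>x. w (cos x) * cos (real m * x))\<bar> \<le> K / ((real m)\<^sup>2 - 1)"
proof -
  obtain s1 s2 B where s: "\<forall>x. (step has_real_derivative s1 x) (at x)"
    "\<forall>x. (s1 has_real_derivative s2 x) (at x)" "\<forall>x. \<bar>s1 x\<bar> \<le> B" "\<forall>x. \<bar>s2 x\<bar> \<le> B"
    "\<forall>x. x < 0 \<or> x > 1 \<longrightarrow> s1 x = 0 \<and> s2 x = 0" "B > 0"
    using step_derivatives by metis
  have "bounded (w ` {-1..1})"
    by (intro compact_imp_bounded compact_continuous_image w) simp
  then obtain M where M: "M > 0" "\<forall>t\<in>{-1..1}. \<bar>w t\<bar> \<le> M"
    unfolding bounded_pos by (auto simp del: atLeastAtMost_iff)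
  define f where "f = (\<lambda>N x. w (cos x) * deriv (deriv (cutoff m N)) (cos x) * sin x)"
  define g where "g = (\<lambda>x. w (cos x) * cos (real m * x))"
  \<comment> \<open>One summand for each of the three terms of \<open>deriv2_cutoff\<close>.\<close>
  define C where "C = 80 * B + 8 * B + 1"
  note nd = ndiff_cutoff[OF m]
  have hi: "(f N has_integral integral {-1..1} (\<lambda>t. w t * deriv (deriv (cutoff m N)) t)) {0..pi}" for N
    unfolding f_def using integral_cos_substitution[of "\<lambda>t. w t * deriv (deriv (cutoff m N)) t"]
    by (simp add: continuous_on_mult[OF w continuous_on_deriv2[OF nd]])
  \<comment> \<open>The formula for the second derivative holds for \<open>0 < x < pi\<close> only,
    so the dominated limit is taken over the open interval.\<close>
  have op: "integral {0<..<pi} h = integral {0..pi} h" for h :: "real \<Rightarrow> real"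
    using integral_open_interval_real[of 0 pi h] by simp
  have m2: "(real m)\<^sup>2 > 1" using m by (intro one_less_power) auto
  have bound_f: "\<bar>integral {0<..<pi} (f N)\<bar> \<le> K / ((real m)\<^sup>2 - 1)" for N
  proof -
    have "\<bar>cutoff m N t\<bar> \<le> 1 / ((real m)\<^sup>2 - 1)" for t
    proof -
      have "\<bar>cutoff m N t\<bar> \<le> 1 * \<bar>psi m (arccos t)\<bar>"
        unfolding cutoff_def abs_mult using step_bounds by (intro mult_right_mono) auto
      with abs_psi_le[OF m, of "arccos t"] show ?thesis by simp
    qed
    then have "\<bar>integral {-1..1} (\<lambda>t. w t * deriv (deriv (cutoff m N)) t)\<bar> \<le> K * (1 / ((real m)\<^sup>2 - 1))"
      using m2 by (intro H[of _ "1 / (real N + 1)"] nd) (auto intro: cutoff_eq_0)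
    then show ?thesis using hi[of N] by (simp add: op integral_unique)
  qed
  have dom: "norm (f N x) \<le> M * C" if x: "x \<in> {0<..<pi}" for N x
  proof -
    let ?c = "real N + 1" and ?s = "sin x"
    define u where "u = ?c * ?s\<^sup>2 - 1"
    have s0: "?s > 0" using x sin_gt_zero by auto
    have "\<bar>deriv (deriv (cutoff m N)) (cos x) * ?s\<bar> \<le> C"
    proof -
      have wm: "\<bar>step u * cos (real m * x)\<bar> \<le> 1"
        unfolding abs_mult using step_bounds[of u] mult_mono[of "\<bar>step u\<bar>" 1 "\<bar>cos (real m * x)\<bar>" 1] by simp
      have sm: "\<bar>sin (real m * x) / real m\<bar> \<le> ?s"
        using abs_sin_mult_le[of m x] s0 m by (simp add: field_simps)
      have ps: "\<bar>psi m x\<bar> \<le> 4 * ?s ^ 3" using abs_psi_le_sin_cubed[OF m] x by auto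
      have c1: "(cos x)\<^sup>2 \<le> 1" "\<bar>cos x\<bar> \<le> 1" by (auto simp: abs_square_le_1)
      have eq: "deriv (deriv (cutoff m N)) (cos x) * ?s =
        (s2 u * (4 * ?c\<^sup>2 * (cos x)\<^sup>2) - 2 * ?c * s1 u) * psi m x * ?s
        + 4 * ?c * cos x * s1 u * sin (real m * x) / real m * ?s + step u * cos (real m * x)"
        unfolding u_def using deriv2_cutoff[OF m _ _ s(1,2), of x N] x by simp
      show ?thesis
      proof (cases "u < 0 \<or> u > 1")
        case True
        then have "s1 u = 0" "s2 u = 0" using s by auto
        then show ?thesis using eq wm s(6) by (simp add: C_def)
      next
        case False
        \<comment> \<open>In the transition zone \<open>N + 1\<close> is at most
          \<open>2 / sin^2 x\<close>. The term with \<open>psi\<close> then has a coefficient of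
          order \<open>sin^(-4)\<close>, exactly offset by the cube from \<open>psi\<close> and the
          Jacobian.\<close>
        then have "?c * ?s\<^sup>2 \<le> 2" by (simp add: u_def)
        then have c: "?c \<le> 2 / ?s\<^sup>2" using s0 by (simp add: field_simps)
        have s1: "?s \<le> 1" by simp
        have "\<bar>s2 u * (4 * ?c\<^sup>2 * (cos x)\<^sup>2) - 2 * ?c * s1 u\<bar> \<le>
            \<bar>s2 u\<bar> * (4 * ?c\<^sup>2 * (cos x)\<^sup>2) + 2 * ?c * \<bar>s1 u\<bar>"
          by (rule order_trans[OF abs_triangle_ineq4]) (simp add: abs_mult)
        also have "\<dots> \<le> B * (4 * (2 / ?s\<^sup>2)\<^sup>2 * 1) + 2 * (2 / ?s\<^sup>2) * B"
          using s c c1 s0 by (intro add_mono mult_mono power_mono) auto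
        also have "\<dots> = (16 * B + 4 * B * ?s\<^sup>2) / ?s ^ 4"
          using s0 by (simp add: field_simps power2_eq_square power4_eq_xxxx)
        also have "\<dots> \<le> (16 * B + 4 * B * 1) / ?s ^ 4"
          using s(6) s0 s1 by (intro divide_right_mono add_mono mult_left_mono power_le_one) auto
        finally have a: "\<bar>s2 u * (4 * ?c\<^sup>2 * (cos x)\<^sup>2) - 2 * ?c * s1 u\<bar> \<le> 20 * B / ?s ^ 4" by simp
        have "\<bar>(s2 u * (4 * ?c\<^sup>2 * (cos x)\<^sup>2) - 2 * ?c * s1 u) * psi m x * ?s\<bar> \<le>
            20 * B / ?s ^ 4 * (4 * ?s ^ 3) * ?s"
          unfolding abs_mult using a ps s0 s(6) by (intro mult_mono) auto
        also have "\<dots> = 80 * B" using s0 by (simp add: field_simps power3_eq_cube power4_eq_xxxx)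
        finally have 1: "\<bar>(s2 u * (4 * ?c\<^sup>2 * (cos x)\<^sup>2) - 2 * ?c * s1 u) * psi m x * ?s\<bar> \<le> 80 * B" .
        have "\<bar>4 * ?c * cos x * s1 u * sin (real m * x) / real m * ?s\<bar> =
            4 * ?c * \<bar>cos x\<bar> * \<bar>s1 u\<bar> * \<bar>sin (real m * x) / real m\<bar> * ?s"
          using s0 by (simp add: abs_mult)
        also have "\<dots> \<le> 4 * (2 / ?s\<^sup>2) * 1 * B * ?s * ?s"
          using c c1 s sm s0 by (intro mult_mono) auto
        also have "\<dots> = 8 * B" using s0 by (simp add: field_simps power2_eq_square)
        finally have 2: "\<bar>4 * ?c * cos x * s1 u * sin (real m * x) / real m * ?s\<bar> \<le> 8 * B" .
        show ?thesis unfolding eq C_def by (intro order_trans[OF abs_triangle_ineq] add_mono 1 2 wm)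
      qed
    qed
    moreover have "\<bar>w (cos x)\<bar> \<le> M" using M by auto
    ultimately have "\<bar>w (cos x)\<bar> * \<bar>deriv (deriv (cutoff m N)) (cos x) * ?s\<bar> \<le> M * C"
      using M by (intro mult_mono) auto
    then show ?thesis by (simp add: f_def abs_mult mult.assoc)
  qed
  have conv: "(\<lambda>N. f N x) \<longlonglongrightarrow> g x" if x: "x \<in> {0<..<pi}" for x
  proof (rule tendsto_eventually)
    have s0: "sin x > 0" using x sin_gt_zero by auto
    \<comment> \<open>A fixed interior point leaves the transition zone for large \<open>N\<close>,
      after which the sequence is constant.\<close>
    have "\<forall>\<^sub>F N in sequentially. 2 / (sin x)\<^sup>2 < real N"
      by (rule eventually_compose_filterlim[OF eventually_gt_at_top filterlim_real_sequentially])
    then show "\<forall>\<^sub>F N in sequentially. f N x = g x"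
    proof eventually_elim
      case (elim N)
      define u where "u = (real N + 1) * (sin x)\<^sup>2 - 1"
      have "2 < real N * (sin x)\<^sup>2" using elim s0 by (simp add: field_simps)
      moreover have "(sin x)\<^sup>2 > 0" using s0 by simp
      ultimately have "u > 1" unfolding u_def distrib_right by linarith
      then have "s1 u = 0" "s2 u = 0" "step u = 1" using s by (auto simp: step_ge_1)
      with deriv2_cutoff[OF m _ _ s(1,2), of x N] x
      have "deriv (deriv (cutoff m N)) (cos x) * sin x = cos (real m * x)" by (simp add: u_def)
      then show ?case by (simp add: f_def g_def mult.assoc)
    qed
  qed
  have "(\<lambda>N. integral {0<..<pi} (f N)) \<longlonglongrightarrow> integral {0<..<pi} g"
  proof (rule dominated_convergence(2)[where h = "\<lambda>_. M * C"])
    show "f N integrable_on {0<..<pi}" for N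
      using hi[of N] integrable_on_open_interval_real[of "f N" 0 pi] by (auto simp: has_integral_integrable)
    show "(\<lambda>_. M * C) integrable_on {0<..<pi}"
      using integrable_on_open_interval_real[of "\<lambda>_. M * C" 0 pi] by (simp add: integrable_const_ivl)
  qed (use dom conv in auto)
  then have "(\<lambda>N. \<bar>integral {0<..<pi} (f N)\<bar>) \<longlonglongrightarrow> \<bar>integral {0<..<pi} g\<bar>" by (rule tendsto_rabs)
  then have "\<bar>integral {0<..<pi} g\<bar> \<le> K / ((real m)\<^sup>2 - 1)"
    by (rule LIMSEQ_le_const2) (use bound_f in auto)
  then show ?thesis by (simp add: op g_def)
qed

subsection \<open>Cosine series\<close>

lemma has_integral_cos_int:
  "((\<lambda>x. cos (real_of_int p * x)) has_integral (if p = 0 then pi else 0)) {0..pi}"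
proof (cases "p = 0")
  case True
  then show ?thesis using has_integral_const_real[of "1::real" 0 pi] by simp
next
  case False
  have "((\<lambda>x. cos (real_of_int p * x)) has_integral
      sin (real_of_int p * pi) / real_of_int p - sin (real_of_int p * 0) / real_of_int p) {0..pi}"
    by (rule fundamental_theorem_of_calculus)
      (use False in \<open>auto intro!: derivative_eq_intros
         simp: has_real_derivative_iff_has_vector_derivative[symmetric]\<close>)
  moreover have "sin (real_of_int p * pi) = 0" by (auto simp: sin_zero_iff_int2)
  ultimately show ?thesis using False by simp
qed

lemma cos_times_cos_int:
  "cos (real_of_int p * x) * cos (real_of_int q * x) =
    (cos (real_of_int (p - q) * x) + cos (real_of_int (p + q) * x)) / 2"
  by (simp add: left_diff_distrib distrib_right cos_add cos_diff)

lemma integral_cos_cos: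
  "integral {0..pi} (\<lambda>x. cos (real j * x) * cos (real i * x)) =
    (if i = j then if i = 0 then pi else pi / 2 else 0)"
proof -
  have "((\<lambda>x. (cos (real_of_int (int j - int i) * x) + cos (real_of_int (int j + int i) * x)) * (1 / 2)) has_integral
    ((if int j - int i = 0 then pi else 0) + (if int j + int i = 0 then pi else 0)) * (1 / 2)) {0..pi}"
    by (intro has_integral_mult_left has_integral_add has_integral_cos_int)
  then have "((\<lambda>x. cos (real_of_int (int j) * x) * cos (real_of_int (int i) * x)) has_integral
    ((if int j - int i = 0 then pi else 0) + (if int j + int i = 0 then pi else 0)) * (1 / 2)) {0..pi}"
    unfolding cos_times_cos_int by simp
  then show ?thesis by (auto simp: integral_unique)
qed

text \<open>Multiplication by \<open>cos x\<close> turns \<open>cos (i * x)\<close> into the mean of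
  its two neighbours. Vanishing cosine moments therefore spread to all polynomials in
  \<open>cos x\<close>.\<close>

lemma cos_moments_zero:
  assumes u: "continuous_on {0..pi} u"
    and z: "\<And>j::nat. integral {0..pi} (\<lambda>x. u x * cos (real j * x)) = 0"
  shows "integral {0..pi} (\<lambda>x. u x * cos x ^ j * cos (real i * x)) = 0"
proof (induction j arbitrary: i)
  case (Suc j)
  have int: "(\<lambda>x. u x * cos x ^ j * cos (real i * x)) integrable_on {0..pi}" for i
    by (intro integrable_continuous_interval continuous_intros u)
  show ?case
  proof (cases i)
    case 0
    then show ?thesis using Suc.IH[of 1] by (simp add: mult_ac)
  next
    case (Suc i')
    have prod_cos: "cos x * cos (real i * x) = (cos (real (Suc i) * x) + cos (real i' * x)) * (1 / 2)" for x
      using cos_times_cos_int[of "int i" x 1] Suc by (simp add: algebra_simps)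
    have "u x * cos x ^ Suc j * cos (real i * x) =
      (u x * cos x ^ j * cos (real (Suc i) * x) + u x * cos x ^ j * cos (real i' * x)) * (1 / 2)" for x
    proof -
      have "u x * cos x ^ Suc j * cos (real i * x) = u x * cos x ^ j * (cos x * cos (real i * x))" by simp
      also have "\<dots> = u x * cos x ^ j * ((cos (real (Suc i) * x) + cos (real i' * x)) * (1 / 2))"
        by (simp only: prod_cos)
      finally show ?thesis by (simp add: algebra_simps)
    qed
    moreover have "integral {0..pi} (\<lambda>x. (u x * cos x ^ j * cos (real (Suc i) * x) + u x * cos x ^ j * cos (real i' * x)) * (1 / 2)) = 0"
      unfolding integral_mult_left integral_add[OF int int] Suc.IH by simp
    ultimately show ?thesis by presburger
  qed
qed (use z in simp)

text \<open>Through \<open>t = cos x\<close>, Weierstrass approximates \<open>u\<close> uniformly by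
  polynomials in \<open>cos x\<close>, all orthogonal to \<open>u\<close>. Hence the integral of
  \<open>u^2\<close> is at most \<epsilon> times that of \<open>\<bar>u\<bar>\<close>, for every
  \<epsilon>.\<close>

lemma cosine_coeffs_zero_imp_zero:
  assumes u: "continuous_on {0..pi} u"
    and z: "\<And>j::nat. integral {0..pi} (\<lambda>x. u x * cos (real j * x)) = 0"
    and x: "x \<in> {0..pi}"
  shows "u x = 0"
proof -
  have cont2: "continuous_on {0..pi} (\<lambda>x. u x * u x)" by (intro continuous_intros u)
  have small: "integral {0..pi} (\<lambda>x. u x * u x) \<le> \<epsilon> * integral {0..pi} (\<lambda>x. \<bar>u x\<bar>)" if \<epsilon>: "\<epsilon> > 0" for \<epsilon>
  proof -
    have "continuous_on {-1..1} (\<lambda>t. u (arccos t))"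
      by (rule continuous_on_compose2[OF u continuous_on_arccos']) (auto simp: arccos_lbound arccos_ubound)
    then obtain p where p: "real_polynomial_function p" "\<And>t. t \<in> {-1..1} \<Longrightarrow> \<bar>u (arccos t) - p t\<bar> < \<epsilon>"
      using Stone_Weierstrass_real_polynomial_function[OF compact_Icc _ \<epsilon>] by blast
    then obtain a N where pa: "p = (\<lambda>x. \<Sum>i\<le>N. a i * x ^ i)"
      using real_polynomial_function_iff_sum by blast
    have pe: "\<bar>u x - p (cos x)\<bar> \<le> \<epsilon>" if "x \<in> {0..pi}" for x
      using p(2)[of "cos x"] that by (simp add: arccos_cos less_imp_le)
    have "integral {0..pi} (\<lambda>x. u x * p (cos x)) = integral {0..pi} (\<lambda>x. \<Sum>i\<le>N. (u x * cos x ^ i * cos (real 0 * x)) * a i)"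
      unfolding pa by (simp add: sum_distrib_left mult_ac)
    also have "\<dots> = (\<Sum>i\<le>N. integral {0..pi} (\<lambda>x. (u x * cos x ^ i * cos (real 0 * x)) * a i))"
      by (rule integral_sum) (auto intro!: integrable_continuous_interval continuous_intros u)
    also have "\<dots> = 0" unfolding integral_mult_left cos_moments_zero[OF u z] by simp
    finally have p0: "integral {0..pi} (\<lambda>x. u x * p (cos x)) = 0" .
    have pc: "continuous_on {0..pi} (\<lambda>x. p (cos x))" unfolding pa by (intro continuous_intros)
    have "integral {0..pi} (\<lambda>x. u x * u x) = integral {0..pi} (\<lambda>x. u x * u x) - integral {0..pi} (\<lambda>x. u x * p (cos x))"
      using p0 by simp
    also have "\<dots> = integral {0..pi} (\<lambda>x. u x * u x - u x * p (cos x))"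
      by (rule integral_diff[symmetric]) (intro integrable_continuous_interval continuous_intros u pc)+
    also have "\<dots> \<le> integral {0..pi} (\<lambda>x. \<epsilon> * \<bar>u x\<bar>)"
    proof (rule integral_le)
      fix x assume "x \<in> {0..pi}"
      have "u x * u x - u x * p (cos x) \<le> \<bar>u x * (u x - p (cos x))\<bar>" by (simp add: algebra_simps)
      also have "\<dots> \<le> \<bar>u x\<bar> * \<epsilon>" unfolding abs_mult using pe \<open>x \<in> {0..pi}\<close> by (intro mult_left_mono) auto
      finally show "u x * u x - u x * p (cos x) \<le> \<epsilon> * \<bar>u x\<bar>" by (simp add: mult.commute)
    qed (intro integrable_continuous_interval continuous_intros u pc)+
    finally show ?thesis by simp
  qed
  have I: "integral {0..pi} (\<lambda>x. \<bar>u x\<bar>) \<ge> 0"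
    by (intro integral_nonneg integrable_continuous_interval continuous_intros u) auto
  have "integral {0..pi} (\<lambda>x. u x * u x) \<le> 0"
  proof (rule field_le_epsilon)
    fix e :: real assume e: "e > 0"
    let ?I = "integral {0..pi} (\<lambda>x. \<bar>u x\<bar>)"
    have "integral {0..pi} (\<lambda>x. u x * u x) \<le> e / (?I + 1) * ?I" using e I by (intro small) simp
    also have "\<dots> \<le> e" using e I by (simp add: field_simps)
    finally show "integral {0..pi} (\<lambda>x. u x * u x) \<le> 0 + e" by simp
  qed
  moreover have "integral {0..pi} (\<lambda>x. u x * u x) \<ge> 0"
    by (intro integral_nonneg integrable_continuous_interval cont2) auto
  ultimately have "integral {0..pi} (\<lambda>x. u x * u x) = 0" by simp
  then have "((\<lambda>x. u x * u x) has_integral 0) (cbox 0 pi)"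
    using integrable_integral[OF integrable_continuous_interval[OF cont2]] by simp
  then have "u x * u x = 0"
    using has_integral_0_cbox_imp_0[of 0 pi "\<lambda>x. u x * u x" x] cont2 x pi_gt_zero by (simp add: box_real not_le)
  then show ?thesis by simp
qed

definition cosine_coeff :: "(real \<Rightarrow> real) \<Rightarrow> nat \<Rightarrow> real" where
  "cosine_coeff F j = 2 / pi * integral {0..pi} (\<lambda>x. F x * cos (real j * x))"

text \<open>Summability makes the series converge uniformly to a continuous \<open>S\<close>, which
  may be integrated term by term. Its moments match those of \<open>F\<close> less the constant
  term, and completeness of the cosines identifies the two.\<close>

lemma cosine_series_sums:
  assumes F: "continuous_on {0..pi} F" and sm: "summable (\<lambda>j. \<bar>cosine_coeff F (Suc j)\<bar>)"
    and x: "x \<in> {0..pi}"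
  shows "(\<lambda>j. cosine_coeff F (Suc j) * cos (real (Suc j) * x)) sums (F x - cosine_coeff F 0 / 2)"
proof -
  define e where "e = cosine_coeff F"
  define s where "s = (\<lambda>N x. \<Sum>j<N. e (Suc j) * cos (real (Suc j) * x))"
  define S where "S = (\<lambda>x. \<Sum>j. e (Suc j) * cos (real (Suc j) * x))"
  have eF: "integral {0..pi} (\<lambda>x. F x * cos (real i * x)) = pi / 2 * e i" for i
    by (simp add: e_def cosine_coeff_def)
  have le: "norm (e (Suc j) * cos (real (Suc j) * x)) \<le> \<bar>e (Suc j)\<bar>" for j x
    unfolding real_norm_def abs_mult using mult_left_mono[of "\<bar>cos (real (Suc j) * x)\<bar>" 1 "\<bar>e (Suc j)\<bar>"] by simp
  have ul: "uniform_limit {0..pi} s S sequentially"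
    unfolding s_def S_def by (rule Weierstrass_m_test[OF le]) (use sm in \<open>simp add: e_def\<close>)
  have sc: "continuous_on {0..pi} (s N)" for N unfolding s_def by (intro continuous_intros)
  have Sc: "continuous_on {0..pi} S"
    by (rule uniform_limit_theorem[OF _ ul]) (use sc in auto)
  define u where "u = (\<lambda>x. F x - e 0 / 2 - S x)"
  have "u x = 0"
  proof (rule cosine_coeffs_zero_imp_zero[OF _ _ x])
    show "continuous_on {0..pi} u" unfolding u_def by (intro continuous_intros F Sc)
    fix i :: nat
    have bc: "bounded ((\<lambda>x. cos (real i * x)) ` {0..pi})" "bounded (S ` {0..pi})"
      by (intro compact_imp_bounded compact_continuous_image continuous_intros Sc; simp)+
    have "uniform_limit {0..pi} (\<lambda>N x. s N x * cos (real i * x)) (\<lambda>x. S x * cos (real i * x)) sequentially"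
      by (rule uniform_lim_mult[OF ul uniform_limit_const bc(2,1)])
    then obtain I J where IJ: "\<And>N. ((\<lambda>x. s N x * cos (real i * x)) has_integral I N) {0..pi}"
      "((\<lambda>x. S x * cos (real i * x)) has_integral J) {0..pi}" "I \<longlonglongrightarrow> J"
      by (rule uniform_limit_integral) (auto intro!: continuous_intros sc)
    have "I N = (\<Sum>j<N. e (Suc j) * (if i = Suc j then pi / 2 else 0))" for N
    proof -
      have "I N = integral {0..pi} (\<lambda>x. s N x * cos (real i * x))" by (rule integral_unique[OF IJ(1), symmetric])
      also have "\<dots> = integral {0..pi} (\<lambda>x. \<Sum>j<N. e (Suc j) * (cos (real (Suc j) * x) * cos (real i * x)))"
        unfolding s_def sum_distrib_right mult.assoc ..
      also have "\<dots> = (\<Sum>j<N. integral {0..pi} (\<lambda>x. e (Suc j) * (cos (real (Suc j) * x) * cos (real i * x))))"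
        by (rule integral_sum) (auto intro!: integrable_continuous_interval continuous_intros)
      also have "\<dots> = (\<Sum>j<N. e (Suc j) * (if i = Suc j then pi / 2 else 0))"
        unfolding integral_mult_right integral_cos_cos by (intro sum.cong) auto
      finally show ?thesis .
    qed
    \<comment> \<open>Past \<open>i\<close> the partial sums contain the only term that is not
      orthogonal to \<open>cos (i * x)\<close>; the constant term is not part of the series.\<close>
    then have I: "I N = (if i = 0 then 0 else pi / 2 * e i)" if "N > i" for N
      using that by (cases i) (auto simp: if_distrib[of "\<lambda>x. _ * x"] sum.delta' cong: if_cong)
    have "I \<longlonglongrightarrow> (if i = 0 then 0 else pi / 2 * e i)"
      by (intro tendsto_eventually eventually_mono[OF eventually_gt_at_top[of i]] I)
    with IJ(3) have J: "J = (if i = 0 then 0 else pi / 2 * e i)" by (rule LIMSEQ_unique)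
    have c0: "integral {0..pi} (\<lambda>x. e 0 / 2 * cos (real i * x)) = (if i = 0 then pi / 2 * e i else 0)"
      using integral_cos_cos[of 0 i] by simp
    have "((\<lambda>x. F x * cos (real i * x)) has_integral pi / 2 * e i) {0..pi}"
      unfolding eF[symmetric] by (intro integrable_integral integrable_continuous_interval continuous_intros F)
    moreover have "((\<lambda>x. e 0 / 2 * cos (real i * x)) has_integral (if i = 0 then pi / 2 * e i else 0)) {0..pi}"
      unfolding c0[symmetric] by (intro integrable_integral integrable_continuous_interval continuous_intros)
    ultimately have "((\<lambda>x. F x * cos (real i * x) - e 0 / 2 * cos (real i * x) - S x * cos (real i * x))
        has_integral pi / 2 * e i - (if i = 0 then pi / 2 * e i else 0) - J) {0..pi}"
      by (intro has_integral_diff IJ(2))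
    then have "((\<lambda>x. u x * cos (real i * x)) has_integral 0) {0..pi}"
      by (cases "i = 0") (simp_all add: u_def left_diff_distrib J)
    then show "integral {0..pi} (\<lambda>x. u x * cos (real i * x)) = 0" by (rule integral_unique)
  qed
  then have "S x = F x - e 0 / 2" by (simp add: u_def)
  moreover have "summable (\<lambda>j. e (Suc j) * cos (real (Suc j) * x))"
    by (rule summable_comparison_test'[of _ 0]) (use le sm in \<open>auto simp: e_def\<close>)
  then have "(\<lambda>j. e (Suc j) * cos (real (Suc j) * x)) sums S x" unfolding S_def by (rule summable_sums)
  ultimately show ?thesis by (simp add: e_def)
qed

subsection \<open>Discrete orthogonality and the quadrature operator\<close>

definition angle :: "nat \<Rightarrow> nat \<Rightarrow> real" where
  "angle n l = (2 * real l - 1) * pi / (2 * real n)"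

definition node_mean :: "nat \<Rightarrow> int \<Rightarrow> real" where
  "node_mean n p = (\<Sum>l=1..n. cos (real_of_int p * angle n l)) / real n"

lemma abs_node_mean_le: "\<bar>node_mean n p\<bar> \<le> 1"
proof -
  have "\<bar>\<Sum>l=1..n. cos (real_of_int p * angle n l)\<bar> \<le> (\<Sum>l=1..n. 1)"
    by (rule order_trans[OF sum_abs]) (intro sum_mono, simp)
  then show ?thesis by (cases "n = 0") (auto simp: node_mean_def abs_divide)
qed

lemma node_mean_0: "n \<ge> 1 \<Longrightarrow> node_mean n 0 = 1"
  by (simp add: node_mean_def)

text \<open>The angles are \<open>pi / n\<close> apart, so multiplying by \<open>2 * sin y\<close>,
  with \<open>y\<close> half of the phase step, makes the sum telescope to
  \<open>sin (p * pi) = 0\<close>. The divisor \<open>sin y\<close> vanishes only if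
  \<open>2 * n\<close> divides \<open>p\<close>.\<close>

lemma node_mean_eq_0:
  assumes n: "n \<ge> 1" and p: "\<not> 2 * int n dvd p"
  shows "node_mean n p = 0"
proof -
  define y where "y = real_of_int p * pi / (2 * real n)"
  have "sin y \<noteq> 0"
  proof
    assume "sin y = 0"
    then obtain i :: int where "y = real_of_int i * pi" by (auto simp: sin_zero_iff_int2)
    then have "real_of_int p = real_of_int (2 * int n * i)" using n by (simp add: y_def field_simps)
    then have "p = 2 * int n * i" by linarith
    then show False using p by simp
  qed
  have "2 * sin y * cos (real_of_int p * angle n l) = sin (2 * real l * y) - sin (2 * (real l - 1) * y)" for l
  proof -
    have "real_of_int p * angle n l = 2 * real l * y - y" by (simp add: angle_def y_def field_simps add_divide_distrib diff_divide_distrib)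
    moreover have "sin (2 * real l * y) = sin ((2 * real l * y - y) + y)"
      "sin (2 * (real l - 1) * y) = sin ((2 * real l * y - y) - y)"
      by (simp_all add: algebra_simps)
    ultimately show ?thesis unfolding sin_add sin_diff by (simp only:) (simp add: algebra_simps)
  qed
  then have "2 * sin y * (\<Sum>l=1..n. cos (real_of_int p * angle n l)) =
      (\<Sum>l=1..n. sin (2 * real l * y) - sin (2 * (real l - 1) * y))"
    by (simp add: sum_distrib_left)
  also have "\<dots> = (\<Sum>l=Suc 0..n. sin (2 * real l * y) - sin (2 * real (l - 1) * y))"
    by (intro sum.cong) (auto simp: of_nat_diff)
  also have "\<dots> = sin (2 * real n * y)"
    using sum_telescope''[of 0 n "\<lambda>l. sin (2 * real l * y)"] by simp
  also have "\<dots> = 0" using n by (simp add: y_def sin_zero_iff_int2)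
  finally show ?thesis using \<open>sin y \<noteq> 0\<close> by (simp add: node_mean_def)
qed

definition quad_coeff :: "nat \<Rightarrow> (real \<Rightarrow> real) \<Rightarrow> nat \<Rightarrow> real" where
  "quad_coeff n F j = 2 / real n * (\<Sum>l=1..n. F (angle n l) * cos (real j * angle n l))"

definition quad_series :: "nat \<Rightarrow> nat \<Rightarrow> (real \<Rightarrow> real) \<Rightarrow> real \<Rightarrow> real" where
  "quad_series d n F x = quad_coeff n F 0 / 2 + (\<Sum>j=1..d. quad_coeff n F j * cos (real j * x))"

lemma sum_symmetric_int:
  fixes h :: "int \<Rightarrow> real"
  shows "(\<Sum>p\<in>{- int d..int d}. h p) = h 0 + (\<Sum>j=1..d. h (int j) + h (- int j))"
proof (induction d)
  case (Suc d)
  have "{- int (Suc d)..int (Suc d)} = insert (int (Suc d)) (insert (- int (Suc d)) {- int d..int d})"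
    by auto
  then have "(\<Sum>p\<in>{- int (Suc d)..int (Suc d)}. h p) = h (int (Suc d)) + (h (- int (Suc d)) + (\<Sum>p\<in>{- int d..int d}. h p))"
    by (simp only: finite_insert finite_atLeastAtMost_int sum.insert) auto
  then show ?case using Suc by simp
qed simp

lemma quad_coeff_cos:
  "quad_coeff n (\<lambda>x. cos (real m * x)) j = node_mean n (int m - int j) + node_mean n (int m + int j)"
proof -
  have "cos (real m * x) * cos (real j * x) = (cos (real_of_int (int m - int j) * x) + cos (real_of_int (int m + int j) * x)) / 2" for x
    using cos_times_cos_int[of "int m" x "int j"] by simp
  then show ?thesis
    by (simp add: quad_coeff_def node_mean_def sum.distrib sum_divide_distrib[symmetric] add_divide_distrib)
qed

text \<open>Signed frequencies absorb both the halved constant term and the two means in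
  \<open>quad_coeff_cos\<close>. Aliasing becomes plain congruence of \<open>m\<close> and
  \<open>p\<close> modulo \<open>2 * n\<close>.\<close>

lemma quad_series_cos:
  assumes "n \<ge> 1"
  shows "quad_series d n (\<lambda>x. cos (real m * x)) x =
    (\<Sum>p | p \<in> {- int d..int d} \<and> 2 * int n dvd int m - p. node_mean n (int m - p) * cos (real_of_int p * x))"
proof -
  have "quad_series d n (\<lambda>x. cos (real m * x)) x =
      (\<Sum>p\<in>{- int d..int d}. node_mean n (int m - p) * cos (real_of_int p * x))"
    unfolding quad_series_def quad_coeff_cos sum_symmetric_int by (simp add: algebra_simps)
  also have "\<dots> = (\<Sum>p | p \<in> {- int d..int d} \<and> 2 * int n dvd int m - p. node_mean n (int m - p) * cos (real_of_int p * x))"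
    using node_mean_eq_0[OF assms] by (intro sum.mono_neutral_right) auto
  finally show ?thesis .
qed

text \<open>Frequencies in \<open>{- d..d}\<close> differ from \<open>m\<close> by at most
  \<open>m + d\<close>, less than \<open>2 * n\<close>, so \<open>p = m\<close> is the only alias.
  The two bounds on \<open>m\<close> are the two arguments of the minimum \<open>M\<close> in
  \<open>quad_series_error\<close>.\<close>

lemma quad_series_cos_exact:
  assumes "n \<ge> 1" "m \<le> d" "m + d < 2 * n"
  shows "quad_series d n (\<lambda>x. cos (real m * x)) x = cos (real m * x)"
proof -
  have "{p. p \<in> {- int d..int d} \<and> 2 * int n dvd int m - p} = {int m}"
  proof (intro equalityI subsetI)
    fix p assume p: "p \<in> {p. p \<in> {- int d..int d} \<and> 2 * int n dvd int m - p}"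
    then have "\<bar>int m - p\<bar> < 2 * int n" using assms by auto
    with p have "int m - p = 0" using zdvd_imp_le[of "2 * int n" "\<bar>int m - p\<bar>"] by (cases "int m - p = 0") auto
    then show "p \<in> {int m}" by simp
  qed (use assms in auto)
  then show ?thesis using assms by (simp add: quad_series_cos node_mean_0)
qed

lemma abs_quad_series_cos_le:
  assumes n: "n \<ge> 1" and d: "d < 2 * n"
  shows "\<bar>quad_series d n (\<lambda>x. cos (real m * x)) x\<bar> \<le> (if d < n then 1 else 2)"
proof -
  let ?A = "{p. p \<in> {- int d..int d} \<and> 2 * int n dvd int m - p}"
  have fin: "finite ?A" by (rule finite_subset[of _ "{- int d..int d}"]) auto
  have card: "card ?A \<le> (if d < n then 1 else 2)"
  proof (cases "?A = {}")
    case False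
    \<comment> \<open>Relative to the least alias, the others lie at multiples of
      \<open>2 * n\<close> not exceeding \<open>2 * d\<close>. That is below \<open>2 * n\<close> if
      \<open>d < n\<close> and below \<open>4 * n\<close> in any case.\<close>
    define q where "q = Min ?A"
    have q: "q \<in> ?A" unfolding q_def using fin False by (rule Min_in)
    have "p = q \<or> (\<not> d < n \<and> p = q + 2 * int n)" if p: "p \<in> ?A" for p
    proof -
      have "q \<le> p" unfolding q_def using fin p by simp
      have "2 * int n dvd int m - q" "2 * int n dvd int m - p" using p q by auto
      then have "2 * int n dvd (int m - q) - (int m - p)" by (rule dvd_diff)
      then have "2 * int n dvd p - q" by simp
      then obtain i where i: "p - q = 2 * int n * i" by (auto simp: dvd_def)
      have "p - q \<le> 2 * int d" using p q by auto
      have "i \<ge> 0"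
      proof (rule ccontr)
        assume "\<not> i \<ge> 0"
        then have "2 * int n * i < 0" using n by (intro mult_pos_neg) auto
        then show False using i \<open>q \<le> p\<close> by linarith
      qed
      moreover have "i < 2"
      proof (rule ccontr)
        assume "\<not> i < 2"
        then have "2 * int n * 2 \<le> 2 * int n * i" by (intro mult_left_mono) auto
        then show False using i \<open>p - q \<le> 2 * int d\<close> d by linarith
      qed
      ultimately have "i = 0 \<or> i = 1" by auto
      then show ?thesis using i \<open>p - q \<le> 2 * int d\<close> by auto
    qed
    then have "?A \<subseteq> (if d < n then {q} else {q, q + 2 * int n})" by auto
    then have "card ?A \<le> card (if d < n then {q} else {q, q + 2 * int n})" by (intro card_mono) auto
    also have "\<dots> \<le> (if d < n then 1 else 2)" by (auto simp: card_insert_if)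
    finally show ?thesis .
  next
    case True
    then have "card ?A = 0" by (simp only: card.empty)
    then show ?thesis by simp
  qed
  have "\<bar>quad_series d n (\<lambda>x. cos (real m * x)) x\<bar> \<le> (\<Sum>p\<in>?A. \<bar>node_mean n (int m - p) * cos (real_of_int p * x)\<bar>)"
    unfolding quad_series_cos[OF n] by (rule sum_abs)
  also have "\<dots> \<le> (\<Sum>p\<in>?A. 1)"
  proof (rule sum_mono)
    fix p show "\<bar>node_mean n (int m - p) * cos (real_of_int p * x)\<bar> \<le> 1"
      unfolding abs_mult using mult_mono[OF abs_node_mean_le abs_cos_le_one] by fastforce
  qed
  also have "\<dots> = real (card ?A)" by simp
  also have "\<dots> \<le> real (if d < n then 1 else 2)" using card by (rule of_nat_mono)
  finally show ?thesis by (auto split: if_splits)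
qed

text \<open>The operator reads a function at finitely many nodes only, so pointwise convergence
  there lets it be exchanged with an infinite sum.\<close>

lemma quad_series_sums:
  assumes "\<And>l. l \<in> {1..n} \<Longrightarrow> (\<lambda>j. h j (angle n l)) sums F (angle n l)"
  shows "(\<lambda>j. quad_series d n (h j) x) sums quad_series d n F x"
  unfolding quad_series_def quad_coeff_def
  by (intro sums_add sums_divide sums_sum sums_mult sums_mult2 assms)

lemma quad_series_scale: "quad_series d n (\<lambda>x. c * F x) x = c * quad_series d n F x"
  unfolding quad_series_def quad_coeff_def by (simp add: algebra_simps sum_distrib_left)

lemma quad_series_diff:
  "quad_series d n (\<lambda>x. F x - G x) x = quad_series d n F x - quad_series d n G x"
  unfolding quad_series_def quad_coeff_def
  by (simp add: algebra_simps sum_subtractf diff_divide_distrib)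

lemma angle_in_range: "l \<in> {1..n} \<Longrightarrow> angle n l \<in> {0..pi}"
proof -
  assume l: "l \<in> {1..n}"
  then have "(2 * real l - 1) * pi \<le> 2 * real n * pi" by (intro mult_right_mono) auto
  then show ?thesis using l by (simp add: angle_def field_simps)
qed

subsection \<open>The decay factors\<close>

text \<open>The factors run from \<open>x - k\<close> to \<open>x + k\<close> in steps of 2.
  Centring the product at \<open>x\<close> lets either outer factor be split off with a shift of
  \<open>x\<close> by 1.\<close>

definition decay :: "nat \<Rightarrow> real \<Rightarrow> real" where
  "decay k x = 1 / (\<Prod>i\<le>k. x - real k + 2 * real i)"

lemma decay_Suc_left: "decay (Suc k) x = decay k (x + 1) / (x - real (Suc k))"
proof -
  have "(\<Prod>i\<le>Suc k. x - real (Suc k) + 2 * real i) = (x - real (Suc k)) * (\<Prod>i\<le>k. x + 1 - real k + 2 * real i)"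
    unfolding prod.atMost_Suc_shift by (simp add: algebra_simps)
  then show ?thesis by (simp add: decay_def)
qed

lemma decay_Suc_right: "decay (Suc k) x = decay k (x - 1) / (x + real (Suc k))"
proof -
  have "(\<Prod>i\<le>Suc k. x - real (Suc k) + 2 * real i) = (x + real (Suc k)) * (\<Prod>i\<le>k. x - 1 - real k + 2 * real i)"
    unfolding prod.atMost_Suc by (simp add: algebra_simps)
  then show ?thesis by (simp add: decay_def)
qed

lemma decay_pos: "x > real k \<Longrightarrow> decay k x > 0"
  unfolding decay_def by (intro divide_pos_pos prod_pos) auto

text \<open>\<open>decay k (x - 1)\<close> and \<open>decay k (x + 1)\<close> are
  \<open>decay (Suc k) x\<close> without its last and its first denominator factor. The difference
  of these factors is constant, which makes the tail telescope.\<close>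

lemma decay_diff:
  assumes "x > real (Suc k)"
  shows "decay k (x - 1) - decay k (x + 1) = 2 * real (Suc k) * decay (Suc k) x"
proof -
  have "decay k (x - 1) = (x + real (Suc k)) * decay (Suc k) x" using assms by (simp add: decay_Suc_right)
  moreover have "decay k (x + 1) = (x - real (Suc k)) * decay (Suc k) x" using assms by (simp add: decay_Suc_left)
  ultimately show ?thesis by (simp add: algebra_simps)
qed

text \<open>Here the outer factors add up to \<open>2 * x\<close>, which cancels the
  \<open>1 / (2 * j)\<close> produced by each integration by parts.\<close>

lemma decay_sum:
  assumes "x > real (Suc k)"
  shows "decay k (x - 1) + decay k (x + 1) = 2 * x * decay (Suc k) x"
proof -
  have "decay k (x - 1) = (x + real (Suc k)) * decay (Suc k) x" using assms by (simp add: decay_Suc_right)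
  moreover have "decay k (x + 1) = (x - real (Suc k)) * decay (Suc k) x" using assms by (simp add: decay_Suc_left)
  ultimately show ?thesis by (simp add: algebra_simps)
qed

lemma sum_decay_le:
  assumes k: "k \<ge> 1" and M: "M \<ge> k + 1"
  shows "(\<Sum>j=M..<M + N. decay k (real j)) \<le> (decay (k - 1) (real M - 1) + decay (k - 1) (real M)) / (2 * real k)"
proof -
  obtain k' where k': "k = Suc k'" using k by (cases k) auto
  \<comment> \<open>The differences have step 2, so two terms survive at either end. Those at the
    upper end are positive and may be dropped.\<close>
  have "2 * real k * (\<Sum>j=M..<M + N. decay k (real j)) = decay k' (real M - 1) + decay k' (real M)
      - decay k' (real (M + N) - 1) - decay k' (real (M + N))"
  proof (induction N)
    case (Suc N)
    have "2 * real k * decay k (real (M + N)) = decay k' (real (M + N) - 1) - decay k' (real (M + N) + 1)"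
      unfolding k' by (rule decay_diff[symmetric]) (use M k' in auto)
    with Suc show ?case by (simp add: distrib_left add_ac)
  qed simp
  moreover have "decay k' (real (M + N) - 1) > 0" "decay k' (real (M + N)) > 0"
    using M k' by (intro decay_pos; simp)+
  ultimately have "2 * real k * (\<Sum>j=M..<M + N. decay k (real j)) \<le> decay k' (real M - 1) + decay k' (real M)"
    by linarith
  then show ?thesis using k k' by (simp add: field_simps)
qed

theorem quad_series_error:
  assumes F: "continuous_on {0..pi} F" and k: "k \<ge> 1" and kn: "k + 1 \<le> n" and kd: "k \<le> d"
    and dn: "d + k + 1 \<le> 2 * n" and A: "A \<ge> 0"
    and coeff: "\<And>j. j \<ge> k + 1 \<Longrightarrow> \<bar>cosine_coeff F j\<bar> \<le> A * decay k (real j)"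
    and x: "x \<in> {0..pi}"
  defines "M \<equiv> min (d + 1) (2 * n - d)"
  shows "\<bar>F x - quad_series d n F x\<bar> \<le>
    (if d < n then 2 else 3) * A * ((decay (k - 1) (real M - 1) + decay (k - 1) (real M)) / (2 * real k))"
proof -
  define e where "e = cosine_coeff F"
  define R :: real where "R = (if d < n then 2 else 3)"
  define T where "T = (decay (k - 1) (real M - 1) + decay (k - 1) (real M)) / (2 * real k)"
  define L where "L = (\<lambda>m. cos (real m * x) - quad_series d n (\<lambda>x. cos (real m * x)) x)"
  have n: "n \<ge> 1" "d < 2 * n" and M: "M \<ge> k + 1" using kn kd dn by (auto simp: M_def)
  have L0: "L m = 0" if "m < M" for m
    using quad_series_cos_exact[OF n(1), of m d x] that by (simp add: L_def M_def less_diff_conv)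
  have LR: "\<bar>L m\<bar> \<le> R" for m
  proof -
    have "\<bar>L m\<bar> \<le> \<bar>cos (real m * x)\<bar> + \<bar>quad_series d n (\<lambda>x. cos (real m * x)) x\<bar>"
      unfolding L_def by (rule abs_triangle_ineq4)
    also have "\<dots> \<le> 1 + (if d < n then 1 else 2)"
      by (intro add_mono abs_cos_le_one abs_quad_series_cos_le[OF n])
    finally show ?thesis by (simp add: R_def split: if_splits)
  qed
  have tail: "(\<Sum>j=M..<M + N. \<bar>e j\<bar>) \<le> A * T" for N
  proof -
    have "(\<Sum>j=M..<M + N. \<bar>e j\<bar>) \<le> (\<Sum>j=M..<M + N. A * decay k (real j))"
      using M coeff by (intro sum_mono) (auto simp: e_def)
    also have "\<dots> \<le> A * T"
      unfolding sum_distrib_left[symmetric] T_def using A M k by (intro mult_left_mono sum_decay_le) auto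
    finally show ?thesis .
  qed
  have sm: "summable (\<lambda>j. \<bar>e j\<bar>)"
  proof (rule iffD1[OF summable_iff_shift[of _ M]])
    show "summable (\<lambda>j. \<bar>e (j + M)\<bar>)"
    proof (rule bounded_imp_summable)
      show "(\<Sum>i\<le>N. \<bar>e (i + M)\<bar>) \<le> A * T" for N
        using tail[of "Suc N"] sum.shift_bounds_nat_ivl[of "\<lambda>j. \<bar>e j\<bar>" 0 M "Suc N"]
        by (simp add: atLeast0LessThan lessThan_Suc_atMost add.commute)
    qed simp
  qed
  then have sm': "summable (\<lambda>j. \<bar>cosine_coeff F (Suc j)\<bar>)"
    using summable_Suc_iff[of "\<lambda>j. \<bar>e j\<bar>"] by (simp add: e_def)
  \<comment> \<open>The constant is written as a multiple of \<open>cos (0 * y)\<close> so that the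
    linear operator applies to it; it disappears afterwards through \<open>L 0 = 0\<close>.\<close>
  have ser: "(\<lambda>j. e (Suc j) * cos (real (Suc j) * y)) sums (F y - e 0 / 2 * cos (real 0 * y))" if "y \<in> {0..pi}" for y
    using cosine_series_sums[OF F sm' that] by (simp add: e_def)
  have "(\<lambda>j. quad_series d n (\<lambda>y. e (Suc j) * cos (real (Suc j) * y)) x) sums
      quad_series d n (\<lambda>y. F y - e 0 / 2 * cos (real 0 * y)) x"
    by (rule quad_series_sums) (intro ser angle_in_range)
  from sums_diff[OF ser[OF x] this]
  have "(\<lambda>j. e (Suc j) * L (Suc j)) sums ((F x - quad_series d n F x) - e 0 / 2 * L 0)"
    unfolding quad_series_scale quad_series_diff L_def by (simp add: algebra_simps)
  then have sums: "(\<lambda>j. e (Suc j) * L (Suc j)) sums (F x - quad_series d n F x)"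
    using L0[of 0] M by simp
  have part: "\<bar>\<Sum>j<N. e (Suc j) * L (Suc j)\<bar> \<le> R * A * T" for N
  proof -
    have "\<bar>\<Sum>j<N. e (Suc j) * L (Suc j)\<bar> \<le> (\<Sum>j<N. \<bar>e (Suc j) * L (Suc j)\<bar>)" by (rule sum_abs)
    also have "\<dots> = (\<Sum>j\<in>Suc ` {..<N}. \<bar>e j * L j\<bar>)" by (simp add: sum.reindex)
    also have "\<dots> \<le> (\<Sum>j=0..<M + Suc N. \<bar>e j * L j\<bar>)" by (intro sum_mono2) auto
    also have "\<dots> = (\<Sum>j=M..<M + Suc N. \<bar>e j * L j\<bar>)"
      using L0 by (intro sum.mono_neutral_right) auto
    also have "\<dots> \<le> (\<Sum>j=M..<M + Suc N. R * \<bar>e j\<bar>)"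
    proof (rule sum_mono)
      fix j show "\<bar>e j * L j\<bar> \<le> R * \<bar>e j\<bar>"
        using mult_right_mono[OF LR[of j], of "\<bar>e j\<bar>"] by (simp add: abs_mult mult.commute)
    qed
    also have "\<dots> \<le> R * (A * T)"
      unfolding sum_distrib_left[symmetric] by (intro mult_left_mono tail) (simp add: R_def)
    finally show ?thesis by (simp add: mult.assoc)
  qed
  have "(\<lambda>N. \<bar>\<Sum>j<N. e (Suc j) * L (Suc j)\<bar>) \<longlonglongrightarrow> \<bar>F x - quad_series d n F x\<bar>"
    using sums unfolding sums_def by (rule tendsto_rabs)
  then have "\<bar>F x - quad_series d n F x\<bar> \<le> R * A * T"
    by (rule LIMSEQ_le_const2) (use part in auto)
  then show ?thesis by (simp add: R_def T_def)
qed

subsection \<open>Pairing with the distributional derivative\<close>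

lemma continuous_on_deriv:
  assumes "\<And>m. ndiff m UNIV f"
  shows "continuous_on S (deriv f)"
  using ndiff_imp_deriv_differentiable[OF assms, where m = 1]
  by (auto intro!: continuous_at_imp_continuous_on differentiable_imp_continuous_within)

text \<open>The affine argument of \<phi> is the inverse of \<open>G_map\<close> as a formula on the
  whole line, whereas \<open>G_inv\<close> is determined on the interval only. The gap \<delta>
  keeps the support away from \<open>a\<close> and \<open>b\<close>.\<close>

lemma test_function_rescale:
  assumes ab: "a < b" and \<phi>: "\<And>m. ndiff m UNIV \<phi>" and \<delta>: "\<delta> > 0" and z: "\<And>t. 1 - t\<^sup>2 < \<delta> \<Longrightarrow> \<phi> t = 0"
  defines "r \<equiv> (b - a) / 2"
  defines "\<Phi> \<equiv> (\<lambda>x. \<phi> (x / r - (a + b) / (b - a)))"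
  shows "test_function a b \<Phi>" "\<And>m. ndiff m UNIV \<Phi>"
    and "deriv (deriv \<Phi>) x = deriv (deriv \<phi>) (x / r - (a + b) / (b - a)) / r\<^sup>2"
proof -
  let ?g = "\<lambda>x. x / r - (a + b) / (b - a)"
  have r: "r > 0" using ab by (simp add: r_def)
  have g: "(?g has_real_derivative 1 / r) (at x)" for x
    using r by (auto intro!: derivative_eq_intros)
  have nd: "ndiff m UNIV \<Phi>" for m
    unfolding \<Phi>_def divide_inverse
    by (rule ndiff_compose[OF \<phi>]) (auto intro!: ndiff_diff ndiff_mult ndiff_const ndiff_ident)
  then show "ndiff m UNIV \<Phi>" for m .
  have d1: "(\<phi> has_real_derivative deriv \<phi> t) (at t)" "(deriv \<phi> has_real_derivative deriv (deriv \<phi>) t) (at t)" for t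
    using ndiff_imp_deriv_differentiable[OF \<phi>, of 0 t] ndiff_imp_deriv_differentiable[OF \<phi>, of 1 t]
    by (simp_all add: DERIV_deriv_iff_real_differentiable)
  have "deriv \<Phi> x = deriv \<phi> (?g x) * (1 / r)" for x
    unfolding \<Phi>_def by (rule DERIV_imp_deriv[OF DERIV_chain2[OF d1(1) g]])
  then have "deriv \<Phi> = (\<lambda>x. deriv \<phi> (?g x) * (1 / r))" by (rule ext)
  moreover have "((\<lambda>x. deriv \<phi> (?g x) * (1 / r)) has_real_derivative deriv (deriv \<phi>) (?g x) * (1 / r) * (1 / r)) (at x)"
    by (rule DERIV_cmult_right[OF DERIV_chain2[OF d1(2) g]])
  ultimately show "deriv (deriv \<Phi>) x = deriv (deriv \<phi>) (?g x) / r\<^sup>2"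
    by (auto dest!: DERIV_imp_deriv simp: power2_eq_square)
  define C where "C = {x. 1 - (?g x)\<^sup>2 \<ge> \<delta>}"
  have "closed C" unfolding C_def using r by (intro closed_Collect_le continuous_intros) auto
  moreover have "{x. \<Phi> x \<noteq> 0} \<subseteq> C" using z by (auto simp: C_def \<Phi>_def not_less[symmetric])
  ultimately have clo: "closure {x. \<Phi> x \<noteq> 0} \<subseteq> C" by (simp add: closure_minimal)
  have "C \<subseteq> {a<..<b}"
  proof
    fix x assume "x \<in> C"
    then have "(?g x)\<^sup>2 < 1" using \<delta> by (simp add: C_def)
    then have "\<bar>?g x\<bar> < 1" by (simp add: abs_square_less_1)
    then have "-1 < ?g x" "?g x < 1" by auto
    moreover have "x / r = 2 * x / (b - a)" by (simp add: r_def)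
    then have "?g x = (2 * x - a - b) / (b - a)" by (simp add: diff_divide_distrib add_divide_distrib)
    ultimately have "- (b - a) < 2 * x - a - b" "2 * x - a - b < b - a"
      using ab by (simp_all add: pos_less_divide_eq pos_divide_less_eq)
    then show "x \<in> {a<..<b}" by simp
  qed
  with clo have sub: "closure {x. \<Phi> x \<noteq> 0} \<subseteq> {a<..<b}" by blast
  with closure_subset[of "{x. \<Phi> x \<noteq> 0}"] have "{x. \<Phi> x \<noteq> 0} \<subseteq> {a..b}" by force
  then have "bounded {x. \<Phi> x \<noteq> 0}" by (rule bounded_subset[rotated]) simp
  then have "compact (closure {x. \<Phi> x \<noteq> 0})" by simp
  with sub show "test_function a b \<Phi>"
    unfolding test_function_def using ndiff_imp_deriv_differentiable[OF nd] by blast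
qed

lemma deriv_eq_0_outside_support:
  assumes "x \<notin> closure {x. \<Phi> x \<noteq> (0::real)}"
  shows "deriv \<Phi> x = 0"
proof -
  have "(\<Phi> has_real_derivative 0) (at x)"
    by (rule has_field_derivative_transform_within_open[of "\<lambda>_. 0" _ _ "- closure {x. \<Phi> x \<noteq> 0}"])
      (use assms closure_subset[of "{x. \<Phi> x \<noteq> 0}"] in \<open>auto\<close>)
  then show ?thesis by (rule DERIV_imp_deriv)
qed

text \<open>\<open>h\<close> is integrable over compact subsets only, but the product lives on the
  compact support of \<Phi>, where \<open>deriv \<Phi>\<close> is bounded.\<close>

lemma set_integrable_mult_test_deriv:
  assumes \<Phi>: "test_function a b \<Phi>" and cont: "continuous_on UNIV (deriv \<Phi>)"
    and h: "\<And>K. compact K \<Longrightarrow> K \<subseteq> {a<..<b} \<Longrightarrow> set_integrable lebesgue K h"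
  shows "set_integrable lebesgue {a<..<b} (\<lambda>x. h x * deriv \<Phi> x)"
proof -
  define K where "K = closure {x. \<Phi> x \<noteq> 0}"
  have K: "compact K" "K \<subseteq> {a<..<b}" using \<Phi> by (auto simp: test_function_def K_def)
  have z: "deriv \<Phi> x = 0" if "x \<notin> K" for x
    using deriv_eq_0_outside_support[of x \<Phi>] that by (simp add: K_def)
  have "bounded (deriv \<Phi> ` K)"
    by (intro compact_imp_bounded compact_continuous_image continuous_on_subset[OF cont] K) simp
  then obtain C where C: "C > 0" "\<forall>x\<in>K. \<bar>deriv \<Phi> x\<bar> \<le> C" unfolding bounded_pos by auto
  have hK: "integrable lebesgue (\<lambda>x. indicator K x *\<^sub>R h x)"
    using h[OF K] by (simp add: set_integrable_def)
  have eq: "indicator {a<..<b} x *\<^sub>R (h x * deriv \<Phi> x) = (indicator K x *\<^sub>R h x) * deriv \<Phi> x" for x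
    using K z[of x] by (auto simp: indicator_def)
  have "deriv \<Phi> \<in> borel_measurable lebesgue"
    by (intro measurable_completion) (use borel_measurable_continuous_onI[OF cont] in simp)
  then have meas: "(\<lambda>x. (indicator K x *\<^sub>R h x) * deriv \<Phi> x) \<in> borel_measurable lebesgue"
    by (rule borel_measurable_times[OF borel_measurable_integrable[OF hK]])
  have bd: "norm ((indicator K x *\<^sub>R h x) * deriv \<Phi> x) \<le> norm (C * (indicator K x *\<^sub>R h x))" for x
    using C mult_right_mono[of "\<bar>deriv \<Phi> x\<bar>" C "\<bar>h x\<bar>"]
    by (cases "x \<in> K") (auto simp: abs_mult mult.commute)
  have "integrable lebesgue (\<lambda>x. (indicator K x *\<^sub>R h x) * deriv \<Phi> x)"
    by (rule Bochner_Integration.integrable_bound[OF integrable_mult_right[OF hK, of C] meas AE_I2]) (rule bd)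
  then show ?thesis unfolding set_integrable_def eq .
qed

text \<open>By the arithmetic-geometric mean inequality \<open>sqrt ((x - a) * (b - x))\<close> is
  at most \<open>(b - a) / 2\<close>, so the weight scaled by that number dominates 1.\<close>

lemma ennreal_abs_integral_le:
  assumes "sets M = sets (restrict_space borel {a<..<b})" and ab: "a < b" and B: "B > 0"
    and \<Phi>: "\<And>x. \<bar>\<Phi> x\<bar> \<le> B"
  shows "ennreal \<bar>LINT x|M. \<Phi> x\<bar> \<le> ennreal ((b - a) / 2 * B) * (\<integral>\<^sup>+x. ennreal (1 / sqrt ((x - a) * (b - x))) \<partial>M)"
proof -
  \<comment> \<open>If \<Phi> is not integrable, its integral is 0 by convention and the bound is
    trivial.\<close>
  have "ennreal \<bar>LINT x|M. \<Phi> x\<bar> \<le> (\<integral>\<^sup>+x. ennreal \<bar>\<Phi> x\<bar> \<partial>M)"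
    using integral_norm_bound_ennreal[of M \<Phi>] by (cases "integrable M \<Phi>") (auto simp: not_integrable_integral_eq)
  also have "\<dots> \<le> (\<integral>\<^sup>+x. ennreal ((b - a) / 2 * B) * ennreal (1 / sqrt ((x - a) * (b - x))) \<partial>M)"
  proof (rule nn_integral_mono)
    fix x assume "x \<in> space M"
    then have x: "a < x" "x < b" using sets_eq_imp_space_eq[OF assms(1)] by (auto simp: space_restrict_space)
    have "sqrt ((x - a) * (b - x)) \<le> ((x - a) + (b - x)) / 2"
      using arith_geo_mean_sqrt[of "x - a" "b - x"] x by simp
    moreover have "sqrt ((x - a) * (b - x)) > 0" using x by simp
    ultimately have "1 \<le> (b - a) / 2 * (1 / sqrt ((x - a) * (b - x)))" by (simp add: field_simps)
    then have "B * 1 \<le> B * ((b - a) / 2 * (1 / sqrt ((x - a) * (b - x))))" using B by (intro mult_left_mono) auto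
    with \<Phi>[of x] have "\<bar>\<Phi> x\<bar> \<le> ((b - a) / 2 * B) * (1 / sqrt ((x - a) * (b - x)))" by (simp add: mult_ac)
    moreover have "0 \<le> (x - a) * (b - x)" using x by (intro mult_nonneg_nonneg) auto
    ultimately show "ennreal \<bar>\<Phi> x\<bar> \<le> ennreal ((b - a) / 2 * B) * ennreal (1 / sqrt ((x - a) * (b - x)))"
      using ab B by (subst ennreal_mult''[symmetric]) (auto simp: ennreal_leI)
  qed
  also have "\<dots> = ennreal ((b - a) / 2 * B) * (\<integral>\<^sup>+x. ennreal (1 / sqrt ((x - a) * (b - x))) \<partial>M)"
  proof (rule nn_integral_cmult)
    have "(\<lambda>x. ennreal (1 / sqrt ((x - a) * (b - x)))) \<in> borel_measurable (restrict_space borel {a<..<b})"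
      by (intro measurable_restrict_space1) measurable
    then show "(\<lambda>x. ennreal (1 / sqrt ((x - a) * (b - x)))) \<in> borel_measurable M"
      using measurable_cong_sets[OF assms(1) refl] by blast
  qed
  finally show ?thesis .
qed

text \<open>One integration by parts moves a derivative from \<Phi> to \<open>W\<close>; the
  distributional derivative of \<open>h\<close> then evaluates the pairing as an integral of \<Phi>
  against \<open>P - N\<close>. The bound holds for every admissible pair, hence for the
  infimum.\<close>

lemma second_deriv_pairing_bound:
  assumes ab: "a < b" and W: "abs_cont_on a b W"
    and ae: "AE x in lebesgue. x \<in> {a<..<b} \<longrightarrow> (W has_real_derivative h x) (at x)"
    and T: "T_norm a b h < \<infinity>" and \<Phi>: "test_function a b \<Phi>" "\<And>m. ndiff m UNIV \<Phi>"
    and B: "B > 0" "\<And>x. \<bar>\<Phi> x\<bar> \<le> B"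
  shows "\<bar>integral {a..b} (\<lambda>x. W x * deriv (deriv \<Phi>) x)\<bar> \<le> (b - a) / 2 * B * enn2real (T_norm a b h)"
proof -
  let ?wt = "\<lambda>x. ennreal (1 / sqrt ((x - a) * (b - x)))"
  define y where "y = \<bar>integral {a..b} (\<lambda>x. W x * deriv (deriv \<Phi>) x)\<bar>"
  define c where "c = (b - a) / 2 * B"
  have c: "c > 0" using ab B by (simp add: c_def)
  note c1 = continuous_on_deriv[OF \<Phi>(2)] and c2 = continuous_on_deriv2[OF \<Phi>(2)]
  have d2: "(deriv \<Phi> has_real_derivative deriv (deriv \<Phi>) x) (at x)" for x
    using ndiff_imp_deriv_differentiable[OF \<Phi>(2), of 1 x] by (simp add: DERIV_deriv_iff_real_differentiable)
  from ae obtain E where E: "E \<in> null_sets lebesgue"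
    "\<And>x. x \<notin> E \<Longrightarrow> x \<in> {a<..<b} \<Longrightarrow> (W has_real_derivative h x) (at x)"
    by (auto elim!: AE_E3)
  have "deriv \<Phi> a = 0" "deriv \<Phi> b = 0"
    using \<Phi>(1) by (auto intro!: deriv_eq_0_outside_support simp: test_function_def)
  moreover have "((\<lambda>x. h x * deriv \<Phi> x + deriv (deriv \<Phi>) x * W x) has_integral W b * deriv \<Phi> b - W a * deriv \<Phi> a) {a..b}"
    by (rule abs_cont_on_has_integral[OF less_imp_le[OF ab] abs_cont_on_mult_C1[OF W d2 c2], of E])
      (use E in \<open>auto intro!: DERIV_mult d2 simp: negligible_iff_null_sets\<close>)
  ultimately have "((\<lambda>x. h x * deriv \<Phi> x + deriv (deriv \<Phi>) x * W x) has_integral 0) {a..b}" by simp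
  \<comment> \<open>This term is continuous, so subtracting it yields the gauge integral of
    \<open>h * deriv \<Phi>\<close> without integrability of \<open>h\<close> up to the
    endpoints.\<close>
  moreover have "((\<lambda>x. W x * deriv (deriv \<Phi>) x) has_integral integral {a..b} (\<lambda>x. W x * deriv (deriv \<Phi>) x)) {a..b}"
    by (intro integrable_integral integrable_continuous_interval continuous_intros c2 abs_cont_on_imp_continuous_on[OF W])
  ultimately have "((\<lambda>x. (h x * deriv \<Phi> x + deriv (deriv \<Phi>) x * W x) - W x * deriv (deriv \<Phi>) x) has_integral
      0 - integral {a..b} (\<lambda>x. W x * deriv (deriv \<Phi>) x)) {a..b}" by (rule has_integral_diff)
  then have part: "integral {a..b} (\<lambda>x. h x * deriv \<Phi> x) = - integral {a..b} (\<lambda>x. W x * deriv (deriv \<Phi>) x)"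
    by (simp add: integral_unique mult.commute)
  \<comment> \<open>Dividing by \<open>c\<close> beforehand gives a lower bound that can be compared
    directly with the infimum in \<open>T_norm\<close>.\<close>
  have "ennreal (y / c) \<le> (\<integral>\<^sup>+x. ?wt x \<partial>P) + (\<integral>\<^sup>+x. ?wt x \<partial>N)" if PN: "distr_deriv_measure a b h P N" for P N
  proof -
    have "set_integrable lebesgue {a<..<b} (\<lambda>x. h x * deriv \<Phi> x)"
      by (rule set_integrable_mult_test_deriv[OF \<Phi>(1) c1]) (use PN in \<open>auto simp: distr_deriv_measure_def\<close>)
    then have "(LINT x:{a<..<b}|lebesgue. h x * deriv \<Phi> x) = integral {a..b} (\<lambda>x. h x * deriv \<Phi> x)"
      by (simp add: set_lebesgue_integral_eq_integral integral_open_interval_real)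
    with part PN \<Phi>(1) have "y = \<bar>(LINT x|P. \<Phi> x) - (LINT x|N. \<Phi> x)\<bar>"
      by (auto simp: distr_deriv_measure_def y_def)
    then have "y \<le> \<bar>LINT x|P. \<Phi> x\<bar> + \<bar>LINT x|N. \<Phi> x\<bar>" using abs_triangle_ineq4 by metis
    then have "ennreal y \<le> ennreal (\<bar>LINT x|P. \<Phi> x\<bar> + \<bar>LINT x|N. \<Phi> x\<bar>)" by (rule ennreal_leI)
    also have "\<dots> = ennreal \<bar>LINT x|P. \<Phi> x\<bar> + ennreal \<bar>LINT x|N. \<Phi> x\<bar>" by simp
    also have "\<dots> \<le> ennreal c * (\<integral>\<^sup>+x. ?wt x \<partial>P) + ennreal c * (\<integral>\<^sup>+x. ?wt x \<partial>N)"
      unfolding c_def using PN ab B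
      by (intro add_mono ennreal_abs_integral_le) (auto simp: distr_deriv_measure_def radon_measure_on_def)
    also have "\<dots> = ennreal c * ((\<integral>\<^sup>+x. ?wt x \<partial>P) + (\<integral>\<^sup>+x. ?wt x \<partial>N))" by (simp add: distrib_left)
    finally have le: "ennreal y \<le> ennreal c * ((\<integral>\<^sup>+x. ?wt x \<partial>P) + (\<integral>\<^sup>+x. ?wt x \<partial>N))" .
    show ?thesis
    proof (cases "(\<integral>\<^sup>+x. ?wt x \<partial>P) + (\<integral>\<^sup>+x. ?wt x \<partial>N)")
      case (real v)
      with le c have "y \<le> c * v" by (simp add: ennreal_mult''[symmetric])
      then have "y / c \<le> v" using c by (simp add: field_simps)
      then show ?thesis unfolding real by (rule ennreal_leI)
    next
      case top
      then show ?thesis by (simp only: top_greatest)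
    qed
  qed
  then have "ennreal (y / c) \<le> T_norm a b h"
    unfolding T_norm_def by (intro INF_greatest) auto
  also have "\<dots> = ennreal (enn2real (T_norm a b h))" using T by simp
  finally have "y / c \<le> enn2real (T_norm a b h)" by (simp add: ennreal_le_iff)
  then show ?thesis using c by (simp add: y_def c_def field_simps)
qed

lemma G_map_continuous: "continuous_on S (G_map a b)"
  unfolding G_map_def[abs_def] by (intro continuous_intros)

lemma G_map_range: "a < b \<Longrightarrow> t \<in> {-1..1} \<Longrightarrow> G_map a b t \<in> {a..b}"
proof -
  assume ab: "a < b" and t: "t \<in> {-1..1}"
  have "(b - a) / 2 * (t + 1) \<le> (b - a) / 2 * 2" "0 \<le> (b - a) / 2 * (t + 1)"
    using ab t by (intro mult_left_mono mult_nonneg_nonneg; simp)+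
  then show ?thesis by (simp add: G_map_def)
qed

lemma G_map_range_open: "a < b \<Longrightarrow> -1 < t \<Longrightarrow> t < 1 \<Longrightarrow> G_map a b t \<in> {a<..<b}"
proof -
  assume ab: "a < b" and t: "-1 < t" "t < 1"
  have "(b - a) / 2 * (t + 1) < (b - a) / 2 * 2" "0 < (b - a) / 2 * (t + 1)"
    using ab t by (intro mult_strict_left_mono mult_pos_pos; simp)+
  then show ?thesis by (simp add: G_map_def)
qed

text \<open>One factor \<open>r\<close> comes from the change of variable, \<open>dx = r dt\<close>
  against \<open>1 / r^2\<close> in the second derivative; the other comes from the weight in
  \<open>T_norm\<close>.\<close>

lemma cosine_integral_bound_T_norm:
  assumes ab: "a < b" and W: "abs_cont_on a b W"
    and ae: "AE x in lebesgue. x \<in> {a<..<b} \<longrightarrow> (W has_real_derivative h x) (at x)"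
    and T: "T_norm a b h < \<infinity>" and m: "m \<ge> 2"
  shows "\<bar>integral {0..pi} (\<lambda>x. W (G_map a b (cos x)) * cos (real m * x))\<bar>
    \<le> ((b - a) / 2)\<^sup>2 * enn2real (T_norm a b h) / ((real m)\<^sup>2 - 1)"
proof (rule cosine_integral_bound[OF _ _ m])
  have Wc: "continuous_on {a..b} W" by (rule abs_cont_on_imp_continuous_on[OF W])
  show "continuous_on {-1..1} (\<lambda>t. W (G_map a b t))"
    by (rule continuous_on_compose2[OF Wc G_map_continuous]) (use G_map_range[OF ab] in auto)
  fix \<phi> :: "real \<Rightarrow> real" and B \<delta> :: real
  assume \<phi>: "\<And>m. ndiff m UNIV \<phi>" and \<delta>: "\<delta> > 0" and z: "\<And>t. 1 - t\<^sup>2 < \<delta> \<Longrightarrow> \<phi> t = 0"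
    and B: "B > 0" "\<And>t. \<bar>\<phi> t\<bar> \<le> B"
  define r where "r = (b - a) / 2"
  have r: "r > 0" using ab by (simp add: r_def)
  define \<Phi> where "\<Phi> = (\<lambda>x. \<phi> (x / r - (a + b) / (b - a)))"
  have tf: "test_function a b \<Phi>" "ndiff m UNIV \<Phi>"
      "deriv (deriv \<Phi>) x = deriv (deriv \<phi>) (x / r - (a + b) / (b - a)) / r\<^sup>2" for m x
    unfolding \<Phi>_def r_def by (rule test_function_rescale[OF ab \<phi> \<delta> z]; assumption)+
  define f where "f = (\<lambda>x. W x * deriv (deriv \<Phi>) x)"
  have subst: "((\<lambda>t. r *\<^sub>R f (G_map a b t)) has_integral integral {G_map a b (-1)..G_map a b 1} f) {-1..1}"
  proof (rule has_integral_substitution[where c = a and d = b])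
    show "G_map a b ` {-1..1} \<subseteq> {a..b}" using G_map_range[OF ab] by auto
    show "continuous_on {a..b} f" unfolding f_def by (intro continuous_on_mult Wc continuous_on_deriv2 tf(2))
    show "(G_map a b has_field_derivative r) (at t within {-1..1})" for t
      unfolding G_map_def[abs_def] r_def by (auto intro!: derivative_eq_intros)
  qed (use ab in \<open>auto simp: G_map_def\<close>)
  have "integral {-1..1} (\<lambda>t. r * f (G_map a b t)) = integral {a..b} f"
  proof -
    have "G_map a b (-1) = a" "G_map a b 1 = b" by (simp_all add: G_map_def field_simps)
    with integral_unique[OF subst] show ?thesis by simp
  qed
  moreover have "r * f (G_map a b t) = 1 / r * (W (G_map a b t) * deriv (deriv \<phi>) t)" for t
  proof -
    have "G_map a b t / r - (a + b) / (b - a) = t"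
    proof -
      have "G_map a b t = r * t + (a + b) / 2" by (simp add: G_map_def r_def field_simps)
      moreover have "(a + b) / 2 / r = (a + b) / (b - a)" using ab by (simp add: r_def field_simps)
      ultimately show ?thesis using r by (simp add: add_divide_distrib)
    qed
    then show ?thesis unfolding f_def tf(3) using r by (simp add: power2_eq_square)
  qed
  ultimately have "1 / r * integral {-1..1} (\<lambda>t. W (G_map a b t) * deriv (deriv \<phi>) t) = integral {a..b} f" by simp
  then have "integral {-1..1} (\<lambda>t. W (G_map a b t) * deriv (deriv \<phi>) t) = r * integral {a..b} f"
    using r by (simp add: field_simps)
  then have "\<bar>integral {-1..1} (\<lambda>t. W (G_map a b t) * deriv (deriv \<phi>) t)\<bar> = r * \<bar>integral {a..b} f\<bar>"
    using r by (simp add: abs_mult)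
  also have "\<dots> \<le> r * (r * B * enn2real (T_norm a b h))"
  proof (rule mult_left_mono)
    show "\<bar>integral {a..b} f\<bar> \<le> r * B * enn2real (T_norm a b h)"
      unfolding f_def r_def by (rule second_deriv_pairing_bound[OF ab W ae T tf(1,2) B(1)]) (simp add: \<Phi>_def B)
  qed (use r in simp)
  finally show "\<bar>integral {-1..1} (\<lambda>t. W (G_map a b t) * deriv (deriv \<phi>) t)\<bar> \<le>
      ((b - a) / 2)\<^sup>2 * enn2real (T_norm a b h) * B"
    by (simp add: r_def power2_eq_square mult_ac)
qed

subsection \<open>Decay of the Chebyshev coefficients\<close>

text \<open>The chain-rule factor \<open>- r * sin x\<close> meets \<open>sin (j * x) / j\<close>,
  and the product of sines is a difference of neighbouring cosines. The boundary terms vanish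
  because \<open>sin (j * pi) = 0\<close>.\<close>

lemma cosine_integral_recurrence:
  fixes u u' :: "real \<Rightarrow> real"
  assumes ab: "a < b" and u': "continuous_on {a..b} u'"
    and der: "\<And>x. x \<in> {a..b} \<Longrightarrow> (u has_real_derivative u' x) (at x within {a..b})"
    and j: "j \<ge> 1"
  shows "integral {0..pi} (\<lambda>x. u (G_map a b (cos x)) * cos (real j * x)) = (b - a) / 2 / (2 * real j) *
    (integral {0..pi} (\<lambda>x. u' (G_map a b (cos x)) * cos (real (j - 1) * x))
     - integral {0..pi} (\<lambda>x. u' (G_map a b (cos x)) * cos (real (j + 1) * x)))"
proof -
  define r where "r = (b - a) / 2"
  let ?g = "\<lambda>x. G_map a b (cos x)"
  have u: "continuous_on {a..b} u" using der by (rule DERIV_continuous_on)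
  have cg: "continuous_on {0..pi} ?g" by (rule continuous_on_compose2[OF G_map_continuous[of UNIV]]) (auto intro!: continuous_intros)
  have rg: "?g x \<in> {a..b}" for x using G_map_range[OF ab, of "cos x"] by auto
  have cu: "continuous_on {0..pi} (\<lambda>x. u (?g x))" "continuous_on {0..pi} (\<lambda>x. u' (?g x))"
    using continuous_on_compose2[OF u cg] continuous_on_compose2[OF u' cg] rg by blast+
  let ?I = "\<lambda>i. integral {0..pi} (\<lambda>x. u' (?g x) * cos (real i * x))"
  have hi: "((\<lambda>x. u' (?g x) * cos (real i * x)) has_integral ?I i) {0..pi}" for i
    by (intro integrable_integral integrable_continuous_interval continuous_intros cu)
  \<comment> \<open>At 0 and \<open>pi\<close> the inner function reaches \<open>b\<close> and
    \<open>a\<close>, where \<open>u\<close> has one-sided derivatives only; hence the fundamental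
    theorem with interior derivatives.\<close>
  have "((\<lambda>x. u (?g x) * cos (real j * x) - r / (2 * real j) *
      (u' (?g x) * cos (real (j - 1) * x) - u' (?g x) * cos (real (j + 1) * x))) has_integral
      u (?g pi) * (sin (real j * pi) / real j) - u (?g 0) * (sin (real j * 0) / real j)) {0..pi}"
  proof (rule fundamental_theorem_of_calculus_interior)
    show "continuous_on {0..pi} (\<lambda>x. u (?g x) * (sin (real j * x) / real j))"
      using j by (intro continuous_intros cu) auto
    fix x assume x: "x \<in> {0<..<pi}"
    have "-1 < cos x" "cos x < 1" using x cos_monotone_0_pi[of 0 x] cos_monotone_0_pi[of x pi] by auto
    then have gx: "?g x \<in> {a<..<b}" by (rule G_map_range_open[OF ab])
    have "(u has_real_derivative u' (?g x)) (at (?g x))"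
      using der[OF rg[of x]] at_within_Icc_at[of a "?g x" b] gx by simp
    moreover have "(?g has_real_derivative - (r * sin x)) (at x)"
      unfolding G_map_def r_def by (auto intro!: derivative_eq_intros)
    ultimately have "((\<lambda>x. u (?g x)) has_real_derivative u' (?g x) * - (r * sin x)) (at x)" by (rule DERIV_chain2)
    moreover have "((\<lambda>x. sin (real j * x) / real j) has_real_derivative cos (real j * x)) (at x)"
      using j by (auto intro!: derivative_eq_intros)
    ultimately have deriv: "((\<lambda>x. u (?g x) * (sin (real j * x) / real j)) has_real_derivative
      u' (?g x) * - (r * sin x) * (sin (real j * x) / real j) + cos (real j * x) * u (?g x)) (at x)"
      by (rule DERIV_mult)
    have "cos (real (j - 1) * x) - cos (real (j + 1) * x) = 2 * (sin (real j * x) * sin x)"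
      using j by (simp add: of_nat_diff left_diff_distrib distrib_right cos_add cos_diff)
    then have eq: "u (?g x) * cos (real j * x) - r / (2 * real j) *
      (u' (?g x) * cos (real (j - 1) * x) - u' (?g x) * cos (real (j + 1) * x)) =
      u' (?g x) * - (r * sin x) * (sin (real j * x) / real j) + cos (real j * x) * u (?g x)"
      unfolding right_diff_distrib[symmetric] by simp
    show "((\<lambda>x. u (?g x) * (sin (real j * x) / real j)) has_vector_derivative
      u (?g x) * cos (real j * x) - r / (2 * real j) *
      (u' (?g x) * cos (real (j - 1) * x) - u' (?g x) * cos (real (j + 1) * x))) (at x)"
      unfolding eq using deriv by (simp only: has_real_derivative_iff_has_vector_derivative)
  qed simp
  moreover have "sin (real j * pi) = 0" by simp
  ultimately have i1: "((\<lambda>x. u (?g x) * cos (real j * x) - r / (2 * real j) *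
      (u' (?g x) * cos (real (j - 1) * x) - u' (?g x) * cos (real (j + 1) * x))) has_integral 0) {0..pi}" by simp
  have i2: "((\<lambda>x. r / (2 * real j) *
      (u' (?g x) * cos (real (j - 1) * x) - u' (?g x) * cos (real (j + 1) * x))) has_integral
      r / (2 * real j) * (?I (j - 1) - ?I (j + 1))) {0..pi}"
    by (intro has_integral_mult_right has_integral_diff hi)
  from has_integral_add[OF i1 i2] have "((\<lambda>x. u (?g x) * cos (real j * x)) has_integral 0 + r / (2 * real j) * (?I (j - 1) - ?I (j + 1))) {0..pi}"
    by (simp only: diff_add_cancel)
  from integral_unique[OF this] show ?thesis by (simp add: r_def)
qed

lemma decay_1: "decay (Suc 0) x = 1 / (x\<^sup>2 - 1)"
  by (simp add: decay_def power2_eq_square algebra_simps)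

text \<open>The induction descends from \<open>D (k - 1)\<close>, whose bound comes from the
  measure, to lower derivatives. The condition \<open>j \<ge> s + 2\<close> keeps all decay factors
  positive and survives the shift to \<open>j - 1\<close> when \<open>s\<close> drops by
  one.\<close>

lemma cosine_integral_decay:
  assumes ab: "a < b" and k: "k \<ge> 1" and D: "abs_cont_derivs a b k f D" and T: "T_norm a b (D k) < \<infinity>"
  defines "r \<equiv> (b - a) / 2" and "V \<equiv> enn2real (T_norm a b (D k))"
  shows "s < k \<Longrightarrow> j \<ge> s + 2 \<Longrightarrow>
    \<bar>integral {0..pi} (\<lambda>x. D (k - 1 - s) (G_map a b (cos x)) * cos (real j * x))\<bar> \<le> r ^ (s + 2) * V * decay (Suc s) (real j)"
proof (induction s arbitrary: j)
  case 0
  have "abs_cont_on a b (D (k - 1))"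
    "AE x in lebesgue. x \<in> {a<..<b} \<longrightarrow> (D (k - 1) has_real_derivative D k x) (at x)"
    using D k by (auto simp: abs_cont_derivs_def)
  from cosine_integral_bound_T_norm[OF ab this T, of j, folded r_def V_def] 0 show ?case
    by (simp add: decay_1 power2_eq_square)
next
  case (Suc s)
  define i where "i = k - 1 - Suc s"
  have i: "Suc i = k - 1 - s" "Suc i < k" using Suc.prems by (auto simp: i_def)
  have r: "r > 0" using ab by (simp add: r_def)
  have V: "V \<ge> 0" by (simp add: V_def)
  let ?I = "\<lambda>j. integral {0..pi} (\<lambda>x. D (Suc i) (G_map a b (cos x)) * cos (real j * x))"
  have "continuous_on {a..b} (D (Suc i))"
    using D i by (intro abs_cont_on_imp_continuous_on) (auto simp: abs_cont_derivs_def)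
  moreover have "(D i has_real_derivative D (Suc i) x) (at x within {a..b})" if "x \<in> {a..b}" for x
    using D i(2) that by (auto simp: abs_cont_derivs_def)
  ultimately have "\<bar>integral {0..pi} (\<lambda>x. D i (G_map a b (cos x)) * cos (real j * x))\<bar> =
      \<bar>r / (2 * real j) * (?I (j - 1) - ?I (j + 1))\<bar>"
    unfolding r_def using Suc.prems by (subst cosine_integral_recurrence[OF ab]) auto
  also have "\<dots> = r / (2 * real j) * \<bar>?I (j - 1) - ?I (j + 1)\<bar>" using r by (simp add: abs_mult)
  also have "\<dots> \<le> r / (2 * real j) * (\<bar>?I (j - 1)\<bar> + \<bar>?I (j + 1)\<bar>)"
    using r by (intro mult_left_mono abs_triangle_ineq4) auto
  also have "\<dots> \<le> r / (2 * real j) * (r ^ (s + 2) * V * decay (Suc s) (real (j - 1)) + r ^ (s + 2) * V * decay (Suc s) (real (j + 1)))"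
    using r Suc.prems Suc.IH[of "j - 1"] Suc.IH[of "j + 1"] i(1) by (intro mult_left_mono add_mono) auto
  also have "\<dots> = r / (2 * real j) * (r ^ (s + 2) * V) * (decay (Suc s) (real j - 1) + decay (Suc s) (real j + 1))"
    using Suc.prems by (simp add: of_nat_diff distrib_left add.commute)
  also have "\<dots> = r ^ (Suc s + 2) * V * decay (Suc (Suc s)) (real j)"
    using decay_sum[of "Suc s" "real j"] Suc.prems by simp
  finally show ?case by (simp add: i_def)
qed

subsection \<open>The error bound\<close>

text \<open>The factors of \<Pi> have step 2 and centre \<open>\<eta> + \<beta> - \<alpha>\<close>,
  and there are \<open>2 * s - \<alpha> + 1\<close> of them. So \<alpha> is a parity correction that
  yields \<open>k\<close> factors for even and odd \<open>k\<close> alike.\<close>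

lemma Pi_ab_eq:
  assumes "int m = 2 * int s - \<alpha>"
  shows "Pi_ab s \<alpha> \<beta> \<eta> = decay m (\<eta> + real_of_int \<beta> - real_of_int \<alpha>)"
proof -
  have "(\<Prod>i\<in>{- int s..int s - \<alpha>}. \<eta> + 2 * real_of_int i + real_of_int \<beta>) =
      (\<Prod>i\<le>m. \<eta> + 2 * real_of_int (int i - int s) + real_of_int \<beta>)"
    by (rule prod.reindex_bij_witness[of _ "\<lambda>i. int i - int s" "\<lambda>i. nat (i + int s)"]) (use assms in auto)
  also have "\<dots> = (\<Prod>i\<le>m. \<eta> + real_of_int \<beta> - real_of_int \<alpha> - real m + 2 * real i)"
  proof (rule prod.cong)
    have "real m = 2 * real s - real_of_int \<alpha>" using assms by linarith
    then show "\<eta> + 2 * real_of_int (int i - int s) + real_of_int \<beta> = \<eta> + real_of_int \<beta> - real_of_int \<alpha> - real m + 2 * real i" for i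
      by simp
  qed simp
  finally show ?thesis by (simp add: Pi_ab_def decay_def)
qed

lemma T_bound_eq:
  assumes k: "k \<ge> 1" and kn: "k + 1 \<le> n" and dn: "d + k + 1 \<le> 2 * n"
  defines "M \<equiv> min (d + 1) (2 * n - d)"
  shows "T_bound a b k V d n = ((b - a) / 2) ^ (k + 2) * ((if d < n then 4 else 6) * V / (real k * pi)) *
    (decay (k - 1) (real M - 1) + decay (k - 1) (real M))"
proof -
  \<comment> \<open>The argument \<open>n - l\<close> is \<open>d = M - 1\<close> below
    \<open>n\<close> but \<open>2 * n - d = M\<close> from \<open>n\<close> on. The shift
    \<open>\<beta> - \<alpha>\<close> in the definition compensates for this difference.\<close>
  have \<eta>: "d < n \<Longrightarrow> real n - real (n - d) = real M - 1" "\<not> d < n \<Longrightarrow> real n - real (d - n) = real M"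
    using dn by (auto simp: M_def of_nat_diff min_def)
  define p where "p = ((b - a) / 2) ^ (k + 2)"
  show ?thesis
  proof (cases "even k")
    case True
    then have "int (k - 1) = 2 * int (k div 2) - 1" using k by auto
    note Pi = Pi_ab_eq[OF this]
    show ?thesis
      unfolding T_bound_def Let_def p_def[symmetric] Pi
      using \<open>even k\<close> \<eta> by (cases "d < n") simp_all
  next
    case False
    then have "int (k - 1) = 2 * int (k div 2) - 0" by (auto elim!: oddE)
    note Pi = Pi_ab_eq[OF this]
    show ?thesis
      unfolding T_bound_def Let_def p_def[symmetric] Pi
      using \<open>odd k\<close> \<eta> by (cases "d < n") simp_all
  qed
qed

lemma L1_norm_le:
  assumes "a < b" "\<And>x. x \<in> {a..b} \<Longrightarrow> \<bar>g x\<bar> \<le> C" "C \<ge> 0"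
  shows "L1_norm a b g \<le> (b - a) * C"
proof (cases "set_integrable lebesgue {a..b} (\<lambda>x. \<bar>g x\<bar>)")
  case True
  have "L1_norm a b g \<le> (LINT x:{a..b}|lebesgue. C)"
    unfolding L1_norm_def using True assms by (intro set_integral_mono) (auto simp: set_integrable_def)
  also have "\<dots> = (b - a) * C" using assms by (simp add: set_lebesgue_integral_def)
  finally show ?thesis .
next
  \<comment> \<open>The integral is then 0 by convention, so no measurability of \<open>g\<close>
    has to be established.\<close>
  case False
  then have "L1_norm a b g = 0"
    by (simp add: L1_norm_def set_lebesgue_integral_def set_integrable_def not_integrable_integral_eq)
  then show ?thesis using assms by simp
qed

lemma cheb_series_eq_quad_series:
  assumes ab: "a < b" and n: "n \<ge> 1" and t: "t \<in> {-1..1}"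
  shows "cheb_series a b d n f (G_map a b t) = quad_series d n (\<lambda>x. f (G_map a b (cos x))) (arccos t)"
proof -
  have "inj_on (G_map a b) {-1..1}" using ab by (auto simp: inj_on_def G_map_def)
  then have G: "G_inv a b (G_map a b t) = t" unfolding G_inv_def using t by (rule inv_into_f_f)
  have coeff: "cheb_coeff a b f j n = quad_coeff n (\<lambda>x. f (G_map a b (cos x))) j" for j
    unfolding cheb_coeff_def quad_coeff_def
  proof (intro arg_cong2[where f = "(*)"] refl sum.cong)
    fix l assume "l \<in> {1..n}"
    then have "arccos (cheb_node n l) = angle n l" "cheb_node n l = cos (angle n l)"
      using angle_in_range[of l n] by (auto simp: cheb_node_def angle_def[symmetric] arccos_cos)
    then show "cheb_T j (cheb_node n l) = cos (real j * angle n l)" "f (G_map a b (cheb_node n l)) = f (G_map a b (cos (angle n l)))"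
      by (auto simp: cheb_T_def)
  qed
  show ?thesis unfolding cheb_series_def quad_series_def coeff G by (simp add: cheb_T_def)
qed

theorem theorem4p1:
  fixes a b :: real and k n d :: nat and f :: "real \<Rightarrow> real" and D :: "nat \<Rightarrow> real \<Rightarrow> real"
  assumes "a < b" and "k \<ge> 1"
    and "abs_cont_derivs a b k f D"
    and "T_norm a b (D k) < \<infinity>"
    and "k + 1 \<le> n" and "k \<le> d" and "d + k + 1 \<le> 2 * n"
  shows "L1_norm a b (\<lambda>x. f x - cheb_series a b d n f x)
           \<le> T_bound a b k (enn2real (T_norm a b (D k))) d n"
proof -
  define r where "r = (b - a) / 2"
  define V where "V = enn2real (T_norm a b (D k))"
  define F where "F = (\<lambda>x. f (G_map a b (cos x)))"
  define M where "M = min (d + 1) (2 * n - d)"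
  define Q where "Q = decay (k - 1) (real M - 1) + decay (k - 1) (real M)"
  define A where "A = 2 / pi * (r ^ (k + 1) * V)"
  define E where "E = (if d < n then 2 else 3) * A * (Q / (2 * real k))"
  have r: "r > 0" using assms by (simp add: r_def)
  have V: "V \<ge> 0" by (simp add: V_def)
  have A: "A \<ge> 0" using r V by (simp add: A_def)
  have M: "M \<ge> k + 1" using assms by (auto simp: M_def)
  then have "Q \<ge> 0" using assms(2) unfolding Q_def by (intro add_nonneg_nonneg less_imp_le decay_pos) auto
  then have E: "E \<ge> 0" using A by (simp add: E_def)
  have Df: "D 0 x = f x" if "x \<in> {a..b}" for x using assms(3) that by (auto simp: abs_cont_derivs_def)
  have FD: "F = (\<lambda>x. D 0 (G_map a b (cos x)))"
    unfolding F_def using Df[OF G_map_range[OF assms(1)]] by auto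
  have "continuous_on {a..b} (D 0)"
    using assms(2,3) by (intro abs_cont_on_imp_continuous_on) (auto simp: abs_cont_derivs_def)
  moreover have "continuous_on {0..pi} (\<lambda>x. G_map a b (cos x))"
    unfolding G_map_def by (intro continuous_intros)
  moreover have "(\<lambda>x. G_map a b (cos x)) ` {0..pi} \<subseteq> {a..b}" using G_map_range[OF assms(1)] by auto
  ultimately have "continuous_on {0..pi} (\<lambda>x. D 0 (G_map a b (cos x)))" by (rule continuous_on_compose2)
  then have F: "continuous_on {0..pi} F" by (simp add: FD)
  have coeff: "\<bar>cosine_coeff F j\<bar> \<le> A * decay k (real j)" if "j \<ge> k + 1" for j
  proof -
    have "\<bar>integral {0..pi} (\<lambda>x. F x * cos (real j * x))\<bar> \<le> r ^ (k + 1) * V * decay k (real j)"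
      \<comment> \<open>The value \<open>s = k - 1\<close> is the end of the descent, where the
        derivative is \<open>D 0\<close> and agrees with \<open>f\<close> on the interval.\<close>
      using cosine_integral_decay[OF assms(1-4), of "k - 1" j] that assms(2) by (simp add: FD r_def V_def)
    then have "2 / pi * \<bar>integral {0..pi} (\<lambda>x. F x * cos (real j * x))\<bar> \<le> 2 / pi * (r ^ (k + 1) * V * decay k (real j))"
      by (intro mult_left_mono) auto
    then show ?thesis by (simp add: cosine_coeff_def A_def abs_mult)
  qed
  have "\<bar>f x - cheb_series a b d n f x\<bar> \<le> E" if x: "x \<in> {a..b}" for x
  proof -
    define t where "t = (x - a) / r - 1"
    have t: "t \<in> {-1..1}" "x = G_map a b t"
      using x assms(1) by (auto simp: t_def r_def G_map_def field_simps)
    have "\<bar>F (arccos t) - quad_series d n F (arccos t)\<bar> \<le> E"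
      unfolding E_def Q_def M_def using assms t(1)
      by (intro quad_series_error F A coeff) (auto simp: arccos_lbound arccos_ubound)
    then show ?thesis
      using cheb_series_eq_quad_series[OF assms(1) _ t(1), of n d f] assms t by (simp add: F_def cos_arccos)
  qed
  then have "L1_norm a b (\<lambda>x. f x - cheb_series a b d n f x) \<le> (b - a) * E"
    using assms(1) E by (intro L1_norm_le) auto
  also have "\<dots> = T_bound a b k V d n"
  proof -
    have "b - a = 2 * r" by (simp add: r_def)
    then show ?thesis
      using T_bound_eq[OF assms(2,5,7), of a b V, folded M_def, folded Q_def, folded r_def]
      by (simp add: E_def A_def mult_ac)
  qed
  finally show ?thesis by (simp add: V_def)
qed

end
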